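(* Let $W_1,\dots,W_k$ be subgroups of $S_d$ and let $\chi_m\colon W_m\to K$ be a one-dimensional character of $W_m$, $m=1,\dots,k$. Let $I_m$ be a left transversal of $W_m$ in $S_d$, let $I=I_1\times\cdots\times I_k$ with the $S_d$-action $s$ described in the context, and let $T(W_1,\dots,W_k)\subseteq I$ be a system of distinct representatives of the $S_d$-orbits in $I$. For $\omega=(\omega_1,\dots,\omega_k)\in T(W_1,\dots,W_k)$ let $\psi_{(\omega_1,\dots,\omega_k)}$ be the one-dimensional character of the group $\omega_1W_1\omega_1^{-1}\cap\cdots\cap\omega_kW_k\omega_k^{-1}$ which is the restriction of $\beta_\omega(\zeta)=\prod_{m=1}^k\chi_m\bigl((s_m(\zeta)(\omega_m))^{-1}\zeta\omega_m\bigr)$. Then $$ N\bigl(Z(\chi_1;p_1,\dots,p_d)\ast\cdots\ast Z(\chi_k;p_1,\dots,p_d)\bigr) $$ is the number of elements $\omega\in T(W_1,\dots,W_k)$ such that $\psi_{(\omega_1,\dots,\omega_k)}=1$ on the stabilizer $\omega_1W_1\omega_1^{-1}\cap\cdots\cap\omega_kW_k\omega_k^{-1}$.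
   Context: $K$ is an algebraically closed field of characteristic zero; $d,k\ge 1$; $S_d$ is the symmetric group. A one-dimensional character of a group $W$ is a homomorphism $\chi\colon W\to K^*$. For each $m$, $s_m\colon S_d\to S(I_m)$ is the homomorphism determined by: $s_m(\zeta)(i)$ is the unique $j\in I_m$ with $j^{-1}\zeta i\in W_m$. The action $s$ of $S_d$ on $I$ is $s(\zeta)(i_1,\dots,i_k)=(s_1(\zeta)(i_1),\dots,s_k(\zeta)(i_k))$. The stabilizer of $(\omega_1,\dots,\omega_k)\in I$ is $\omega_1W_1\omega_1^{-1}\cap\cdots\cap\omega_kW_k\omega_k^{-1}$. For $W\le S_d$ and a one-dimensional character $\chi$ of $W$, the generalized cyclic index is $$Z(\chi;p_1,\dots,p_d)=|W|^{-1}\sum_{\sigma\in W}\chi(\sigma)p_1^{c_1(\sigma)}\cdots p_d^{c_d(\sigma)},$$ where $c_s(\sigma)$ is the number of cycles of length $s$ of $\sigma$ and $p_s=\sum_{i\ge 0}x_i^s$ are the power sums in the variables $x_0,x_1,x_2,\dots$. Let $R^d$ be the group of generalized (virtual) characters of $S_d$, $\Lambda^d$ the group of homogeneous degree $d$ symmetric functions with integer coefficients in $x_0,x_1,\dots$, and $ch\colon R^d\to\Lambda^d$ the (bijective) characteristic map $ch(u)=\frac1{d!}\sum_{\sigma\in S_d}u(\sigma)p_1^{c_1(\sigma)}\cdots p_d^{c_d(\sigma)}$. One has $Z(\chi;p_1,\dots,p_d)=ch(\mathrm{ind}_W^{S_d}(\chi))\in\Lambda^d$. The internal product on $\Lambda^d$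 is defined by $ch(u)\ast ch(v)=ch(uv)$, with $uv$ the pointwise product. For a polynomial $A$ in $p_1,\dots,p_d$ (every element of $\Lambda^d$ is uniquely such a polynomial with rational coefficients), $N(A)$ denotes the sum of its coefficients, i.e. its value at $p_1=\cdots=p_d=1$. *)

theory Defs
  imports
    "HOL-Library.Poly_Mapping"
    "HOL-Library.FuncSet"
    "HOL-Computational_Algebra.Polynomial"
    "HOL-Combinatorics.Orbits"
    "HOL-Algebra.Sym_Groups"
    "HOL-Algebra.Left_Coset"
    "HOL-Algebra.Group_Action"
    "Jordan_Normal_Form.Matrix"
begin

section \<open>Formal power series in the variables x_0, x_1, x_2, ...\<close>

text \<open>
  A symmetric function is a formal power series in infinitely many variables. An element of the
  following type assigns a coefficient to every monomial; the monomial that is the product of the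
  powers of x_i with exponents m_i is encoded by its finitely supported exponent function m.
\<close>

typedef 'a xseries = "UNIV :: ((nat \<Rightarrow>\<^sub>0 nat) \<Rightarrow> 'a) set"
  morphisms xcoeff Abs_xseries by simp

setup_lifting type_definition_xseries

lemma xseries_eqI: "(\<And>m. xcoeff f m = xcoeff g m) \<Longrightarrow> f = g"
  by transfer auto

definition splittings :: "(nat \<Rightarrow>\<^sub>0 nat) \<Rightarrow> ((nat \<Rightarrow>\<^sub>0 nat) \<times> (nat \<Rightarrow>\<^sub>0 nat)) set" where
  "splittings m = {(a, b). a + b = m}"

lemma finite_splittings: "finite (splittings m)"
proof -
  let ?F = "{f. \<forall>i. (i \<in> Poly_Mapping.keys m \<longrightarrow> f i \<in> {..Max (range (Poly_Mapping.lookup m))}) \<and>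
                     (i \<notin> Poly_Mapping.keys m \<longrightarrow> f i = (0::nat))}"
  have fr: "finite (range (Poly_Mapping.lookup m))"
  proof (rule finite_subset)
    show "range (Poly_Mapping.lookup m) \<subseteq> insert 0 (Poly_Mapping.lookup m ` Poly_Mapping.keys m)"
      by (auto simp: in_keys_iff)
  qed simp
  have finF: "finite ?F"
    by (rule finite_set_of_finite_funs) auto
  have sub: "Poly_Mapping.lookup a \<in> ?F" if "a + b = m" for a b :: "nat \<Rightarrow>\<^sub>0 nat"
  proof -
    have le: "Poly_Mapping.lookup a i \<le> Poly_Mapping.lookup m i" for i
      using that by (auto simp: lookup_add)
    have "Poly_Mapping.lookup m i \<le> Max (range (Poly_Mapping.lookup m))" for i
      using fr by (intro Max_ge) auto
    with le have "Poly_Mapping.lookup a i \<le> Max (range (Poly_Mapping.lookup m))" for i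
      by (meson le_trans)
    moreover have "Poly_Mapping.lookup a i = 0" if "i \<notin> Poly_Mapping.keys m" for i
      using le[of i] that by (simp add: in_keys_iff)
    ultimately show ?thesis by simp
  qed
  have "Poly_Mapping.lookup ` {a. \<exists>b. a + b = m} \<subseteq> ?F"
    by (intro image_subsetI) (elim CollectE exE, rule sub)
  hence "finite (Poly_Mapping.lookup ` {a. \<exists>b. a + b = m})"
    using finF by (rule finite_subset)
  moreover have "inj_on Poly_Mapping.lookup {a :: nat \<Rightarrow>\<^sub>0 nat. \<exists>b. a + b = m}"
    by (rule inj_onI) (simp add: poly_mapping_eqI)
  ultimately have fin: "finite {a. \<exists>b. a + b = m}"
    by (rule finite_imageD)
  have "splittings m \<subseteq> (\<lambda>a. (a, m - a)) ` {a. \<exists>b. a + b = m}"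
    by (auto simp: splittings_def image_iff)
  with fin show ?thesis
    by (meson finite_imageI finite_subset)
qed

instantiation xseries :: (comm_ring_1) comm_ring_1
begin

lift_definition zero_xseries :: "'a xseries" is "\<lambda>_. 0" .
lift_definition one_xseries :: "'a xseries" is "\<lambda>m. if m = 0 then 1 else 0" .
lift_definition plus_xseries :: "'a xseries \<Rightarrow> 'a xseries \<Rightarrow> 'a xseries" is "\<lambda>f g m. f m + g m" .
lift_definition minus_xseries :: "'a xseries \<Rightarrow> 'a xseries \<Rightarrow> 'a xseries" is "\<lambda>f g m. f m - g m" .
lift_definition uminus_xseries :: "'a xseries \<Rightarrow> 'a xseries" is "\<lambda>f m. - f m" .
lift_definition times_xseries :: "'a xseries \<Rightarrow> 'a xseries \<Rightarrow> 'a xseries"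
  is "\<lambda>f g m. \<Sum>(a, b)\<in>splittings m. f a * g b" .

instance
proof
  fix f g h :: "'a xseries"
  show "f * g * h = f * (g * h)"
  proof (transfer, rule ext)
    fix f g h :: "(nat \<Rightarrow>\<^sub>0 nat) \<Rightarrow> 'a" and m
    have "(\<Sum>(a, b)\<in>splittings m. (\<Sum>(c, e)\<in>splittings a. f c * g e) * h b)
        = (\<Sum>p\<in>splittings m. \<Sum>q\<in>splittings (fst p). f (fst q) * g (snd q) * h (snd p))"
      by (simp add: case_prod_beta sum_distrib_right)
    also have "\<dots> = (\<Sum>(p, q)\<in>Sigma (splittings m) (\<lambda>p. splittings (fst p)).
                       f (fst q) * g (snd q) * h (snd p))"
      by (subst sum.Sigma) (auto simp: finite_splittings)
    also have "\<dots> = (\<Sum>(p, q)\<in>Sigma (splittings m) (\<lambda>p. splittings (snd p)).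
                       f (fst p) * (g (fst q) * h (snd q)))"
      by (rule sum.reindex_bij_witness[where
            i = "\<lambda>(p, q). ((fst p + fst q, snd q), (fst p, fst q))" and
            j = "\<lambda>(p, q). ((fst q, snd q + snd p), (snd q, snd p))"])
         (auto simp: splittings_def ac_simps)
    also have "\<dots> = (\<Sum>p\<in>splittings m. \<Sum>q\<in>splittings (snd p). f (fst p) * (g (fst q) * h (snd q)))"
      by (subst sum.Sigma) (auto simp: finite_splittings)
    also have "\<dots> = (\<Sum>(a, b)\<in>splittings m. f a * (\<Sum>(c, e)\<in>splittings b. g c * h e))"
      by (simp add: case_prod_beta sum_distrib_left)
    finally show "(\<Sum>(a, b)\<in>splittings m. (\<Sum>(c, e)\<in>splittings a. f c * g e) * h b) =
                  (\<Sum>(a, b)\<in>splittings m. f a * (\<Sum>(c, e)\<in>splittings b. g c * h e))" .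
  qed
  show "f * g = g * f"
  proof (transfer, rule ext)
    fix f g :: "(nat \<Rightarrow>\<^sub>0 nat) \<Rightarrow> 'a" and m
    show "(\<Sum>(a, b)\<in>splittings m. f a * g b) = (\<Sum>(a, b)\<in>splittings m. g a * f b)"
      by (rule sum.reindex_bij_witness[where i = prod.swap and j = prod.swap])
         (auto simp: splittings_def ac_simps)
  qed
  show "1 * f = f"
  proof (transfer, rule ext)
    fix f :: "(nat \<Rightarrow>\<^sub>0 nat) \<Rightarrow> 'a" and m
    have "(\<Sum>(a, b)\<in>splittings m. (if a = 0 then 1 else 0) * f b) =
          (\<Sum>(a, b)\<in>{(0 :: nat \<Rightarrow>\<^sub>0 nat, m)}. (if a = 0 then 1 else 0) * f b)"
      by (rule sum.mono_neutral_right) (auto simp: finite_splittings, auto simp: splittings_def split: if_splits)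
    thus "(\<Sum>(a, b)\<in>splittings m. (if a = 0 then 1 else 0) * f b) = f m" by simp
  qed
  show "(f + g) * h = f * h + g * h"
    by transfer (auto simp: fun_eq_iff case_prod_beta algebra_simps sum.distrib)
  show "(0 :: 'a xseries) \<noteq> 1"
    by transfer (metis zero_neq_one)
qed (transfer; simp add: fun_eq_iff algebra_simps)+

end

lift_definition xconst :: "'a::zero \<Rightarrow> 'a xseries" is "\<lambda>c m. if m = 0 then c else 0" .

text \<open>The power sum of exponent s, meaningful for s at least 1.\<close>

lift_definition power_sum :: "nat \<Rightarrow> 'a::zero_neq_one xseries"
  is "\<lambda>s m. if \<exists>i. m = Poly_Mapping.single i s then 1 else 0" .

section \<open>Characters and the characteristic map\<close>

text \<open>Fixed points in \<open>{1..d}\<close> count as cycles of length 1.\<close>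

definition cycle_count :: "nat \<Rightarrow> (nat \<Rightarrow> nat) \<Rightarrow> nat \<Rightarrow> nat" where
  "cycle_count d \<sigma> s = card {C \<in> Orbits.orbit \<sigma> ` {1..d}. card C = s}"

definition cycle_monomial :: "nat \<Rightarrow> (nat \<Rightarrow> nat) \<Rightarrow> 'a::field_char_0 xseries" where
  "cycle_monomial d \<sigma> = (\<Prod>s = 1..d. power_sum s ^ cycle_count d \<sigma> s)"

definition field_units :: "'a::field monoid" where
  "field_units = \<lparr>carrier = UNIV - {0}, mult = (*), one = 1\<rparr>"

definition one_dim_character ::
    "nat \<Rightarrow> (nat \<Rightarrow> nat) set \<Rightarrow> ((nat \<Rightarrow> nat) \<Rightarrow> 'a::field) \<Rightarrow> bool" where
  "one_dim_character d W \<chi> \<longleftrightarrow> \<chi> \<in> hom ((sym_group d)\<lparr>carrier := W\<rparr>) field_units"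

definition GL :: "nat \<Rightarrow> 'a::field mat monoid" where
  "GL n = units_of (ring_mat TYPE('a) n ())"

text \<open>
  Functions on the symmetric group are extended by 0 to all functions on \<open>nat\<close>, so that a
  function on the group has exactly one representative.
\<close>

definition characters :: "nat \<Rightarrow> ((nat \<Rightarrow> nat) \<Rightarrow> 'a::field) set" where
  "characters d = {u. \<exists>n. \<exists>\<rho> \<in> hom (sym_group d) (GL n).
     u = (\<lambda>\<sigma>. if \<sigma> \<in> carrier (sym_group d) then (\<Sum>i<n. \<rho> \<sigma> $$ (i, i)) else 0)}"

definition virtual_characters :: "nat \<Rightarrow> ((nat \<Rightarrow> nat) \<Rightarrow> 'a::field) set" where
  "virtual_characters d = {\<lambda>\<sigma>. u \<sigma> - v \<sigma> | u v. u \<in> characters d \<and> v \<in> characters d}"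

definition ch :: "nat \<Rightarrow> ((nat \<Rightarrow> nat) \<Rightarrow> 'a::field_char_0) \<Rightarrow> 'a xseries" where
  "ch d u = xconst (1 / of_nat (fact d)) *
     (\<Sum>\<sigma>\<in>carrier (sym_group d). xconst (u \<sigma>) * cycle_monomial d \<sigma>)"

definition gen_cyclic_index ::
    "nat \<Rightarrow> (nat \<Rightarrow> nat) set \<Rightarrow> ((nat \<Rightarrow> nat) \<Rightarrow> 'a::field_char_0) \<Rightarrow> 'a xseries" where
  "gen_cyclic_index d W \<chi> = xconst (1 / of_nat (card W)) *
     (\<Sum>\<sigma>\<in>W. xconst (\<chi> \<sigma>) * cycle_monomial d \<sigma>)"

text \<open>
  The internal product is the pointwise product of virtual characters transported along \<open>ch\<close>,
  which is injective on virtual characters; it is meaningful on the image of \<open>ch\<close> only.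
\<close>

definition internal_prod ::
    "nat \<Rightarrow> 'a::field_char_0 xseries \<Rightarrow> 'a xseries \<Rightarrow> 'a xseries" where
  "internal_prod d A B =
     ch d (\<lambda>\<sigma>. inv_into (virtual_characters d) (ch d) A \<sigma> *
                inv_into (virtual_characters d) (ch d) B \<sigma>)"

text \<open>The product of A 1, ..., A k for k at least 1.\<close>

definition internal_prod_family ::
    "nat \<Rightarrow> nat \<Rightarrow> (nat \<Rightarrow> 'a::field_char_0 xseries) \<Rightarrow> 'a xseries" where
  "internal_prod_family d k A = foldl (internal_prod d) (A 1) (map A [2..<Suc k])"

section \<open>The sum of the coefficients with respect to the power sums\<close>

text \<open>
  An element of type \<open>(nat \<Rightarrow>\<^sub>0 nat) \<Rightarrow>\<^sub>0 'a\<close> is a polynomial; here its variable number s stands for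
  the power sum of exponent s.
\<close>

definition eval_power_sums :: "((nat \<Rightarrow>\<^sub>0 nat) \<Rightarrow>\<^sub>0 'a::field_char_0) \<Rightarrow> 'a xseries" where
  "eval_power_sums P =
     (\<Sum>m\<in>Poly_Mapping.keys P. xconst (Poly_Mapping.lookup P m) *
        (\<Prod>s\<in>Poly_Mapping.keys m. power_sum s ^ Poly_Mapping.lookup m s))"

text \<open>
  The power sums with exponents 1, ..., d are algebraically independent, so the polynomial is
  unique. For a symmetric function with integer coefficients it is the polynomial with rational
  coefficients, viewed over the larger field.
\<close>

definition power_sum_poly :: "nat \<Rightarrow> 'a::field_char_0 xseries \<Rightarrow> ((nat \<Rightarrow>\<^sub>0 nat) \<Rightarrow>\<^sub>0 'a)" where
  "power_sum_poly d A = (THE P.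
     (\<forall>m\<in>Poly_Mapping.keys P. Poly_Mapping.keys m \<subseteq> {1..d}) \<and>
     eval_power_sums P = A)"

definition coeff_sum :: "nat \<Rightarrow> 'a::field_char_0 xseries \<Rightarrow> 'a" where
  "coeff_sum d A =
     (\<Sum>m\<in>Poly_Mapping.keys (power_sum_poly d A). Poly_Mapping.lookup (power_sum_poly d A) m)"

section \<open>Transversals and the action on tuples\<close>

definition left_transversal :: "nat \<Rightarrow> (nat \<Rightarrow> nat) set \<Rightarrow> (nat \<Rightarrow> nat) set \<Rightarrow> bool" where
  "left_transversal d W J \<longleftrightarrow> J \<subseteq> carrier (sym_group d) \<and>
     (\<forall>C \<in> lcosets\<^bsub>sym_group d\<^esub> W. \<exists>!j. j \<in> J \<inter> C)"

definition transversal_action ::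
    "nat \<Rightarrow> (nat \<Rightarrow> nat) set \<Rightarrow> (nat \<Rightarrow> nat) set \<Rightarrow> (nat \<Rightarrow> nat) \<Rightarrow> (nat \<Rightarrow> nat) \<Rightarrow> (nat \<Rightarrow> nat)" where
  "transversal_action d W J \<zeta> i =
     (THE j. j \<in> J \<and> inv\<^bsub>sym_group d\<^esub> j \<otimes>\<^bsub>sym_group d\<^esub> \<zeta> \<otimes>\<^bsub>sym_group d\<^esub> i \<in> W)"

text \<open>A k-tuple is a function on \<open>{1..k}\<close> that is \<open>undefined\<close> elsewhere.\<close>

definition tuples :: "nat \<Rightarrow> (nat \<Rightarrow> (nat \<Rightarrow> nat) set) \<Rightarrow> (nat \<Rightarrow> nat \<Rightarrow> nat) set" where
  "tuples k I = (\<Pi>\<^sub>E m\<in>{1..k}. I m)"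

definition tuple_action ::
    "nat \<Rightarrow> nat \<Rightarrow> (nat \<Rightarrow> (nat \<Rightarrow> nat) set) \<Rightarrow> (nat \<Rightarrow> (nat \<Rightarrow> nat) set) \<Rightarrow>
     (nat \<Rightarrow> nat) \<Rightarrow> (nat \<Rightarrow> nat \<Rightarrow> nat) \<Rightarrow> (nat \<Rightarrow> nat \<Rightarrow> nat)" where
  "tuple_action d k W I \<zeta> \<omega> = (\<lambda>m\<in>{1..k}. transversal_action d (W m) (I m) \<zeta> (\<omega> m))"

definition orbit_representatives ::
    "nat \<Rightarrow> nat \<Rightarrow> (nat \<Rightarrow> (nat \<Rightarrow> nat) set) \<Rightarrow> (nat \<Rightarrow> (nat \<Rightarrow> nat) set) \<Rightarrow>
     (nat \<Rightarrow> nat \<Rightarrow> nat) set \<Rightarrow> bool" where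
  "orbit_representatives d k W I T \<longleftrightarrow> T \<subseteq> tuples k I \<and>
     (\<forall>C \<in> orbits (sym_group d) (tuples k I) (tuple_action d k W I). \<exists>!\<omega>. \<omega> \<in> T \<inter> C)"

definition conj_intersection ::
    "nat \<Rightarrow> nat \<Rightarrow> (nat \<Rightarrow> (nat \<Rightarrow> nat) set) \<Rightarrow> (nat \<Rightarrow> nat \<Rightarrow> nat) \<Rightarrow> (nat \<Rightarrow> nat) set" where
  "conj_intersection d k W \<omega> =
     (\<Inter>m\<in>{1..k}. (\<omega> m <#\<^bsub>sym_group d\<^esub> W m) #>\<^bsub>sym_group d\<^esub> (inv\<^bsub>sym_group d\<^esub> (\<omega> m)))"

definition beta ::
    "nat \<Rightarrow> nat \<Rightarrow> (nat \<Rightarrow> (nat \<Rightarrow> nat) set) \<Rightarrow> (nat \<Rightarrow> (nat \<Rightarrow> nat) set) \<Rightarrow>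
     (nat \<Rightarrow> (nat \<Rightarrow> nat) \<Rightarrow> 'a::field) \<Rightarrow> (nat \<Rightarrow> nat \<Rightarrow> nat) \<Rightarrow> (nat \<Rightarrow> nat) \<Rightarrow> 'a" where
  "beta d k W I \<chi> \<omega> \<zeta> =
     (\<Prod>m = 1..k. \<chi> m (inv\<^bsub>sym_group d\<^esub> (transversal_action d (W m) (I m) \<zeta> (\<omega> m))
                           \<otimes>\<^bsub>sym_group d\<^esub> \<zeta> \<otimes>\<^bsub>sym_group d\<^esub> \<omega> m))"

definition psi ::
    "nat \<Rightarrow> nat \<Rightarrow> (nat \<Rightarrow> (nat \<Rightarrow> nat) set) \<Rightarrow> (nat \<Rightarrow> (nat \<Rightarrow> nat) set) \<Rightarrow>
     (nat \<Rightarrow> (nat \<Rightarrow> nat) \<Rightarrow> 'a::field) \<Rightarrow> (nat \<Rightarrow> nat \<Rightarrow> nat) \<Rightarrow> (nat \<Rightarrow> nat) \<Rightarrow> 'a" where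
  "psi d k W I \<chi> \<omega> = restrict (beta d k W I \<chi> \<omega>) (conj_intersection d k W \<omega>)"

end

theory Submission
  imports Defs
begin

text \<open>
  The induced character of \<open>\<chi>\<^sub>m\<close> sums \<open>\<chi>\<^sub>m(i\<^sup>-\<^sup>1 \<zeta> i)\<close> over the \<open>i \<in> I\<^sub>m\<close> fixed by \<open>\<zeta>\<close>. Multiplying
  out, the product of the induced characters sums \<open>\<beta>\<^sub>\<omega>(\<zeta>)\<close> over the tuples \<open>\<omega>\<close> fixed by \<open>\<zeta>\<close>; it is
  the character of the monomial representation on tuples with cocycle \<open>\<beta>\<close>. For a class function
  \<open>u\<close>, the coefficient sum of \<open>ch u\<close> is the average of \<open>u\<close>. Summing over \<open>\<zeta>\<close> first, a tuple
  contributes the order of its stabilizer if \<open>\<beta>\<^sub>\<omega>\<close> is trivial there and 0 otherwise, so by the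
  orbit-stabilizer theorem every orbit contributes 1 or 0. That the internal product may be computed
  on these characters rests on the injectivity of \<open>ch\<close>: the power sums are algebraically
  independent, and permutations of equal cycle type are conjugate.
\<close>

section \<open>Algebraic independence of the power sums\<close>

lemma xcoeff_0 [simp]: "xcoeff 0 m = 0"
  by (simp add: zero_xseries.rep_eq)

lemma xcoeff_add [simp]: "xcoeff (f + g) m = xcoeff f m + xcoeff g m"
  by (simp add: plus_xseries.rep_eq)

lemma xcoeff_sum: "xcoeff (\<Sum>x\<in>S. f x) m = (\<Sum>x\<in>S. xcoeff (f x) m)"
  by (induction S rule: infinite_finite_induct) simp_all

lemma xcoeff_mult: "xcoeff (f * g) m = (\<Sum>(a, b)\<in>splittings m. xcoeff f a * xcoeff g b)"
  by (simp add: times_xseries.rep_eq)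

lemma xcoeff_xconst: "xcoeff (xconst c) m = (if m = 0 then c else 0)"
  by (simp add: xconst.rep_eq)

lemma xcoeff_power_sum:
  "xcoeff (power_sum s) m = (if \<exists>i. m = Poly_Mapping.single i s then 1 else 0)"
  by (simp add: power_sum.rep_eq)

lemma xcoeff_xconst_mult [simp]: "xcoeff (xconst c * f) m = c * xcoeff f m"
proof -
  have "xcoeff (xconst c * f) m = (\<Sum>(a, b)\<in>{(0, m)}. xcoeff (xconst c) a * xcoeff f b)"
    unfolding xcoeff_mult
    by (rule sum.mono_neutral_right)
       (auto simp: finite_splittings[unfolded splittings_def] xcoeff_xconst splittings_def split: if_splits)
  thus ?thesis by (simp add: xcoeff_xconst)
qed

lemma xconst_mult: "xconst (a * b) = xconst a * (xconst b :: 'a::comm_ring_1 xseries)"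
  by (rule xseries_eqI) (simp add: xcoeff_xconst)

lemma xconst_0 [simp]: "xconst 0 = 0"
  by (rule xseries_eqI) (simp add: xcoeff_xconst)

lemma xconst_add: "xconst (a + b) = xconst a + (xconst b :: 'a::comm_ring_1 xseries)"
  by (rule xseries_eqI) (simp add: xcoeff_xconst)

lemma xconst_sum: "xconst (sum f S) = (\<Sum>x\<in>S. xconst (f x) :: 'a::comm_ring_1 xseries)"
  by (induction S rule: infinite_finite_induct) (simp_all add: xconst_add)

text \<open>Choosing one variable in each factor of a product of power sums with exponents in \<open>A\<close>
  yields the monomial \<open>M\<close>.\<close>

inductive power_sum_monomial :: "nat multiset \<Rightarrow> (nat \<Rightarrow>\<^sub>0 nat) \<Rightarrow> bool" where
  empty: "power_sum_monomial {#} 0"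
| add: "power_sum_monomial A M \<Longrightarrow> power_sum_monomial (add_mset s A) (Poly_Mapping.single i s + M)"

lemma sum_Nats:
  assumes "\<And>x. x \<in> S \<Longrightarrow> f x \<in> \<nat>"
  shows "sum f S \<in> \<nat>"
  using assms by (induction S rule: infinite_finite_induct) auto

text \<open>Natural coefficients exclude cancellation, so a monomial reached by one choice of
  variables really occurs in the expansion.\<close>

lemma xcoeff_prod_power_sum_in_Nats:
  "xcoeff (\<Prod>s\<in>#A. power_sum s) M \<in> (\<nat> :: 'a::comm_ring_1 set)"
proof (induction A arbitrary: M)
  case empty
  show ?case by (simp add: one_xseries.rep_eq)
next
  case (add s A)
  show ?case
    using add.IH
    by (auto simp: xcoeff_mult xcoeff_power_sum case_prod_beta intro!: sum_Nats Nats_mult)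
qed

lemma power_sum_monomial_if_xcoeff_nonzero:
  assumes "xcoeff (\<Prod>s\<in>#A. power_sum s) M \<noteq> (0 :: 'a::comm_ring_1)"
  shows "power_sum_monomial A M"
  using assms
proof (induction A arbitrary: M)
  case empty
  thus ?case by (auto simp: one_xseries.rep_eq power_sum_monomial.empty split: if_splits)
next
  case (add s A)
  then obtain a b where "(a, b) \<in> splittings M"
    and "xcoeff (power_sum s) a * xcoeff (\<Prod>s\<in>#A. power_sum s) b \<noteq> (0 :: 'a)"
    by (auto simp: xcoeff_mult elim!: sum.not_neutral_contains_not_neutral)
  with add.IH[of b] show ?case
    by (auto simp: splittings_def xcoeff_power_sum power_sum_monomial.add split: if_splits)
qed

text \<open>The convolution is a sum of naturals with at least one nonzero term, and characteristic
  zero keeps this sum nonzero.\<close>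

lemma xcoeff_nonzero_if_power_sum_monomial:
  assumes "power_sum_monomial A M"
  shows "xcoeff (\<Prod>s\<in>#A. power_sum s) M \<noteq> (0 :: 'a::field_char_0)"
  using assms
proof induction
  case empty
  show ?case by (simp add: one_xseries.rep_eq)
next
  case (add A M s i)
  define f :: "(nat \<Rightarrow>\<^sub>0 nat) \<times> (nat \<Rightarrow>\<^sub>0 nat) \<Rightarrow> 'a" where
    "f = (\<lambda>(a, b). xcoeff (power_sum s) a * xcoeff (\<Prod>s\<in>#A. power_sum s) b)"
  define S where "S = splittings (Poly_Mapping.single i s + M)"
  have "f p \<in> \<nat>" for p
    by (auto simp: f_def xcoeff_power_sum case_prod_beta intro!: Nats_mult xcoeff_prod_power_sum_in_Nats)
  hence "\<forall>p. \<exists>n. f p = of_nat n" by (meson Nats_cases)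
  \<comment> \<open>The field carries no order; positivity of the terms is used on the natural
    numbers \<open>g p\<close> behind the values \<open>f p\<close>.\<close>
  then obtain g where g: "\<And>p. f p = of_nat (g p)" by metis
  have mem: "(Poly_Mapping.single i s, M) \<in> S"
    by (simp add: S_def splittings_def)
  have "f (Poly_Mapping.single i s, M) \<noteq> 0"
    using add.IH by (auto simp: f_def xcoeff_power_sum)
  hence "g (Poly_Mapping.single i s, M) \<noteq> 0" by (simp add: g)
  hence "sum g S \<noteq> 0"
    using mem by (auto simp: S_def finite_splittings)
  hence "sum f S \<noteq> 0" by (simp add: g flip: of_nat_sum)
  thus ?case by (simp add: xcoeff_mult f_def S_def case_prod_beta)
qed

text \<open>Each factor brings in at most one new variable. If the count is attained, all chosen
  variables differ, and each carries the exponent of its own factor.\<close>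

lemma power_sum_monomial_card_keys:
  assumes "power_sum_monomial A M" and "0 \<notin># A"
  shows "card (Poly_Mapping.keys M) \<le> size A \<and>
    (card (Poly_Mapping.keys M) = size A \<longrightarrow>
      image_mset (Poly_Mapping.lookup M) (mset_set (Poly_Mapping.keys M)) = A)"
  using assms
proof induction
  case empty
  show ?case by simp
next
  case (add A M s i)
  let ?N = "Poly_Mapping.single i s + M"
  have s: "s \<noteq> 0" using add.prems by auto
  have keys: "Poly_Mapping.keys ?N = insert i (Poly_Mapping.keys M)"
    using s by (auto simp: in_keys_iff lookup_add lookup_single when_def split: if_splits)
  have IH: "card (Poly_Mapping.keys M) \<le> size A"
    "card (Poly_Mapping.keys M) = size A \<Longrightarrow>
      image_mset (Poly_Mapping.lookup M) (mset_set (Poly_Mapping.keys M)) = A"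
    using add by auto
  show ?case
  proof (cases "i \<in> Poly_Mapping.keys M")
    case True
    thus ?thesis using IH(1) by (simp add: keys insert_absorb)
  next
    case False
    have "image_mset (Poly_Mapping.lookup ?N) (mset_set (Poly_Mapping.keys M)) =
          image_mset (Poly_Mapping.lookup M) (mset_set (Poly_Mapping.keys M))"
      using False by (intro image_mset_cong) (auto simp: lookup_add lookup_single when_def)
    moreover have "Poly_Mapping.lookup ?N i = s"
      using False by (simp add: lookup_add in_keys_iff)
    ultimately show ?thesis using IH False by (simp add: keys)
  qed
qed

text \<open>There are infinitely many variables, so each factor can be given a fresh one; its
  nonzero exponent makes it visible in \<open>keys\<close>.\<close>

lemma ex_power_sum_monomial_distinct_variables:
  assumes "0 \<notin># A"
  shows "\<exists>M. power_sum_monomial A M \<and> card (Poly_Mapping.keys M) = size A"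
  using assms
proof (induction A)
  case empty
  show ?case using power_sum_monomial.empty by force
next
  case (add s A)
  then obtain M where M: "power_sum_monomial A M" "card (Poly_Mapping.keys M) = size A" by auto
  have s: "s \<noteq> 0" using add.prems by auto
  obtain i where i: "i \<notin> Poly_Mapping.keys M"
    using ex_new_if_finite[OF infinite_UNIV_nat finite_keys] by blast
  have "Poly_Mapping.keys (Poly_Mapping.single i s + M) = insert i (Poly_Mapping.keys M)"
    using s by (auto simp: in_keys_iff lookup_add lookup_single when_def split: if_splits)
  hence "card (Poly_Mapping.keys (Poly_Mapping.single i s + M)) = size (add_mset s A)"
    using i M(2) by simp
  with power_sum_monomial.add[OF M(1)] show ?case by blast
qed

section \<open>Polynomials evaluated at the power sums\<close>

definition exponent_mset :: "(nat \<Rightarrow>\<^sub>0 nat) \<Rightarrow> nat multiset" where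
  "exponent_mset m = (\<Sum>s\<in>Poly_Mapping.keys m. replicate_mset (Poly_Mapping.lookup m s) s)"

lemma count_exponent_mset [simp]: "count (exponent_mset m) s = Poly_Mapping.lookup m s"
  by (simp add: exponent_mset_def count_sum in_keys_iff)

lemma exponent_mset_inject: "exponent_mset m = exponent_mset n \<longleftrightarrow> m = n"
  by (metis count_exponent_mset poly_mapping_eqI)

text \<open>Passing to a multiset of factors makes the results on \<open>power_sum_monomial\<close>,
  proved one factor at a time, available for the terms of a polynomial.\<close>

lemma prod_power_sum_exponent_mset:
  "(\<Prod>s\<in>Poly_Mapping.keys m. power_sum s ^ Poly_Mapping.lookup m s) =
   (\<Prod>s\<in>#exponent_mset m. power_sum s :: 'a::comm_ring_1 xseries)"
proof -
  have "prod_mset (image_mset power_sum (\<Sum>s\<in>S. replicate_mset (f s) s)) =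
      (\<Prod>s\<in>S. power_sum s ^ f s :: 'a xseries)" if "finite S" for S f
    using that by (induction S rule: finite_induct) auto
  thus ?thesis by (simp add: exponent_mset_def)
qed

lemma eval_power_sums_superset:
  assumes "finite S" "Poly_Mapping.keys P \<subseteq> S"
  shows "eval_power_sums P =
    (\<Sum>m\<in>S. xconst (Poly_Mapping.lookup P m) * (\<Prod>s\<in>#exponent_mset m. power_sum s))"
  unfolding eval_power_sums_def prod_power_sum_exponent_mset
  using assms by (intro sum.mono_neutral_left) (auto simp: in_keys_iff)

lemma eval_power_sums_add: "eval_power_sums (P + Q) = eval_power_sums P + eval_power_sums Q"
proof -
  let ?S = "Poly_Mapping.keys P \<union> Poly_Mapping.keys Q"
  have "Poly_Mapping.keys (P + Q) \<subseteq> ?S" by (rule Poly_Mapping.keys_add)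
  thus ?thesis
    using eval_power_sums_superset[of ?S P] eval_power_sums_superset[of ?S Q]
      eval_power_sums_superset[of ?S "P + Q"]
    by (simp add: lookup_add xconst_add distrib_right sum.distrib)
qed

lemma eval_power_sums_0 [simp]: "eval_power_sums 0 = 0"
  by (simp add: eval_power_sums_def)

lemma eval_power_sums_sum: "eval_power_sums (\<Sum>x\<in>S. P x) = (\<Sum>x\<in>S. eval_power_sums (P x))"
  by (induction S rule: infinite_finite_induct) (simp_all add: eval_power_sums_add)

lemma eval_power_sums_single:
  "eval_power_sums (Poly_Mapping.single m c) =
   xconst c * (\<Prod>s\<in>Poly_Mapping.keys m. power_sum s ^ Poly_Mapping.lookup m s)"
  by (simp add: eval_power_sums_def)

text \<open>Take a term of \<open>P\<close> with the largest number of factors. A monomial in as many variables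
  as there are factors determines the exponents of these factors, so it occurs in the expansion
  of no other term of \<open>P\<close>.\<close>

lemma eval_power_sums_eq_0D:
  assumes "\<And>m. m \<in> Poly_Mapping.keys P \<Longrightarrow> 0 \<notin> Poly_Mapping.keys m"
    and eval: "eval_power_sums P = (0 :: 'a::field_char_0 xseries)"
  shows "P = 0"
proof (rule ccontr)
  assume "P \<noteq> 0"
  hence ne: "Poly_Mapping.keys P \<noteq> {}" by simp
  define n where "n = Max ((\<lambda>m. size (exponent_mset m)) ` Poly_Mapping.keys P)"
  have "n \<in> (\<lambda>m. size (exponent_mset m)) ` Poly_Mapping.keys P"
    unfolding n_def using ne by (intro Max_in) auto
  then obtain m where m: "m \<in> Poly_Mapping.keys P" "size (exponent_mset m) = n" by auto
  have le: "size (exponent_mset m') \<le> n" if "m' \<in> Poly_Mapping.keys P" for m'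
    unfolding n_def using that by (intro Max_ge) auto
  have zero: "0 \<notin># exponent_mset m'" if "m' \<in> Poly_Mapping.keys P" for m'
    using assms(1)[OF that] count_eq_zero_iff[of "exponent_mset m'" 0]
    by (auto simp: in_keys_iff)
  obtain M where M: "power_sum_monomial (exponent_mset m) M" "card (Poly_Mapping.keys M) = n"
    using ex_power_sum_monomial_distinct_variables[OF zero[OF m(1)]] m(2) by auto
  have other: "xcoeff (\<Prod>s\<in>#exponent_mset m'. power_sum s) M = (0 :: 'a)"
    if m': "m' \<in> Poly_Mapping.keys P" "m' \<noteq> m" for m'
  proof (rule ccontr)
    assume "xcoeff (\<Prod>s\<in>#exponent_mset m'. power_sum s) M \<noteq> (0 :: 'a)"
    hence "power_sum_monomial (exponent_mset m') M"
      by (rule power_sum_monomial_if_xcoeff_nonzero)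
    from power_sum_monomial_card_keys[OF this zero[OF m'(1)]]
      power_sum_monomial_card_keys[OF M(1) zero[OF m(1)]] le[OF m'(1)] M(2) m(2)
    have "exponent_mset m' = exponent_mset m" by simp
    with m'(2) show False by (simp add: exponent_mset_inject)
  qed
  have "0 = xcoeff (eval_power_sums P) M" by (simp add: eval)
  also have "\<dots> = (\<Sum>m'\<in>Poly_Mapping.keys P. Poly_Mapping.lookup P m' *
      xcoeff (\<Prod>s\<in>#exponent_mset m'. power_sum s) M)"
    by (simp add: eval_power_sums_def prod_power_sum_exponent_mset xcoeff_sum)
  also have "\<dots> = (\<Sum>m'\<in>{m}. Poly_Mapping.lookup P m' *
      xcoeff (\<Prod>s\<in>#exponent_mset m'. power_sum s) M)"
    using m(1) other by (intro sum.mono_neutral_right) auto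
  finally show False
    using m(1) xcoeff_nonzero_if_power_sum_monomial[OF M(1), where 'a = 'a]
    by (simp add: in_keys_iff)
qed

text \<open>By additivity this reduces to the kernel. Variable 0 is excluded because
  \<open>power_sum 0\<close> is the series 1.\<close>

lemma eval_power_sums_inject:
  assumes "\<And>m. m \<in> Poly_Mapping.keys P \<Longrightarrow> 0 \<notin> Poly_Mapping.keys m"
    and "\<And>m. m \<in> Poly_Mapping.keys Q \<Longrightarrow> 0 \<notin> Poly_Mapping.keys m"
    and "eval_power_sums P = (eval_power_sums Q :: 'a::field_char_0 xseries)"
  shows "P = Q"
proof -
  have "eval_power_sums (P - Q) + eval_power_sums Q = eval_power_sums P"
    by (simp flip: eval_power_sums_add)
  hence "eval_power_sums (P - Q) = 0" using assms(3) by simp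
  moreover have "0 \<notin> Poly_Mapping.keys m" if "m \<in> Poly_Mapping.keys (P - Q)" for m
    using that assms(1,2) Poly_Mapping.keys_diff[of P Q] by blast
  ultimately have "P - Q = 0" by (intro eval_power_sums_eq_0D)
  thus ?thesis by simp
qed

lemma power_sum_poly_eval:
  assumes "\<And>m. m \<in> Poly_Mapping.keys P \<Longrightarrow> Poly_Mapping.keys m \<subseteq> {1..d}"
  shows "power_sum_poly d (eval_power_sums P) = P"
  unfolding power_sum_poly_def
proof (rule the_equality)
  fix Q
  assume Q: "(\<forall>m\<in>Poly_Mapping.keys Q. Poly_Mapping.keys m \<subseteq> {1..d}) \<and>
    eval_power_sums Q = eval_power_sums P"
  have "0 \<notin> Poly_Mapping.keys m" if "Poly_Mapping.keys m \<subseteq> {1..d}" for m :: "nat \<Rightarrow>\<^sub>0 nat"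
    using that by auto
  with Q assms show "Q = P" by (intro eval_power_sums_inject) auto
qed (use assms in auto)

section \<open>The coefficient sum as an additive map on polynomials\<close>

definition coeff_total :: "('b \<Rightarrow>\<^sub>0 'a::comm_monoid_add) \<Rightarrow> 'a" where
  "coeff_total P = (\<Sum>m\<in>Poly_Mapping.keys P. Poly_Mapping.lookup P m)"

lemma coeff_total_superset:
  assumes "finite S" "Poly_Mapping.keys P \<subseteq> S"
  shows "coeff_total P = (\<Sum>m\<in>S. Poly_Mapping.lookup P m)"
  unfolding coeff_total_def using assms by (intro sum.mono_neutral_left) (auto simp: in_keys_iff)

lemma coeff_total_add: "coeff_total (P + Q) = coeff_total P + coeff_total Q"
proof -
  let ?S = "Poly_Mapping.keys P \<union> Poly_Mapping.keys Q"
  have "Poly_Mapping.keys (P + Q) \<subseteq> ?S" by (rule Poly_Mapping.keys_add)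
  thus ?thesis
    using coeff_total_superset[of ?S P] coeff_total_superset[of ?S Q]
      coeff_total_superset[of ?S "P + Q"]
    by (simp add: lookup_add sum.distrib)
qed

lemma coeff_total_single: "coeff_total (Poly_Mapping.single m c) = c"
  by (simp add: coeff_total_def)

lemma coeff_total_sum: "coeff_total (\<Sum>x\<in>S. P x) = (\<Sum>x\<in>S. coeff_total (P x))"
  by (induction S rule: infinite_finite_induct) (simp_all add: coeff_total_add, simp_all add: coeff_total_def)

section \<open>Cycle types and conjugacy\<close>

text \<open>The map \<open>g\<close> carries the cycles of \<open>p\<close> bijectively onto those
  of the conjugate and preserves their sizes.\<close>

lemma cycle_count_conj:
  assumes g: "g permutes {1..d}" and p: "p permutes {1..d}"
  shows "cycle_count d (g \<circ> p \<circ> inv' g) s = cycle_count d p s"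
proof -
  let ?q = "g \<circ> p \<circ> inv' g"
  have perm: "permutation p" using p by (auto simp: permutation_permutes)
  have inj: "inj g" using g by (rule permutes_inj)
  have orb: "g ` Orbits.orbit p a = Orbits.orbit ?q (g a)" for a
    using permutation_self_in_orbit[OF perm] inj by (intro orbit_inverse) auto
  have "Orbits.orbit ?q ` {1..d} = Orbits.orbit ?q ` g ` {1..d}"
    by (simp only: permutes_image[OF g])
  also have "\<dots> = (`) g ` Orbits.orbit p ` {1..d}"
    by (simp add: image_image orb)
  finally have "{C \<in> Orbits.orbit ?q ` {1..d}. card C = s} =
      (`) g ` {C \<in> Orbits.orbit p ` {1..d}. card C = s}"
    using card_image[OF inj_on_subset[OF inj subset_UNIV]] by auto
  moreover have "inj_on ((`) g) X" for X
    using inj by (simp add: inj_on_def inj_image_eq_iff)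
  ultimately show ?thesis by (simp add: cycle_count_def card_image)
qed

text \<open>Iterates at \<open>a\<close> agree exactly modulo the least period of \<open>a\<close>,
  and the iterates below that period enumerate the orbit without repetition, so period and orbit
  size coincide.\<close>

lemma funpow_eq_iff_mod_card_orbit:
  assumes "permutation p"
  shows "(p ^^ i) a = (p ^^ j) a \<longleftrightarrow>
    i mod card (Orbits.orbit p a) = j mod card (Orbits.orbit p a)"
proof -
  define l where "l = least_power p a"
  have l: "(p ^^ l) a = a" "l > 0"
    using least_power_of_permutation[OF assms] by (auto simp: l_def)
  have inj: "inj (p ^^ n)" for n
    using assms by (simp add: bij_is_inj permutation_bijective inj_fn)
  have le: "(p ^^ i) a = (p ^^ j) a \<longleftrightarrow> i mod l = j mod l" if "i \<le> j" for i j
  proof -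
    have "(p ^^ j) a = (p ^^ i) ((p ^^ (j - i)) a)"
      using that using funpow_add[of i "j - i" p] by simp
    hence "(p ^^ i) a = (p ^^ j) a \<longleftrightarrow> (p ^^ (j - i)) a = a"
      using inj[of i] by (metis injD)
    also have "\<dots> \<longleftrightarrow> l dvd j - i"
      using least_power_dvd[OF assms] by (simp add: l_def)
    also have "\<dots> \<longleftrightarrow> i mod l = j mod l"
      using that by (metis mod_eq_dvd_iff_nat)
    finally show ?thesis .
  qed
  have iff: "(p ^^ i) a = (p ^^ j) a \<longleftrightarrow> i mod l = j mod l" for i j
    using le[of i j] le[of j i] by (cases "i \<le> j") auto
  have "Orbits.orbit p a = (\<lambda>m. (p ^^ m) a) ` {..<l}"
    using orbit_altdef_bounded[OF l] by auto
  moreover have "inj_on (\<lambda>m. (p ^^ m) a) {..<l}"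
    by (auto simp: inj_on_def iff)
  ultimately have "card (Orbits.orbit p a) = l" by (simp add: card_image)
  with iff show ?thesis by simp
qed

text \<open>Match the cycles of \<open>\<sigma>\<close> with cycles of \<open>\<tau>\<close> of the
  same length, choose base points in both, and send the n-th iterate of a base point to the n-th
  iterate of its partner.\<close>

lemma conj_if_cycle_count_eq:
  assumes \<sigma>: "\<sigma> permutes {1..d}" and \<tau>: "\<tau> permutes {1..d}"
    and eq: "\<And>s. s \<in> {1..d} \<Longrightarrow> cycle_count d \<sigma> s = cycle_count d \<tau> s"
  obtains g where "g permutes {1..d}" "\<tau> = g \<circ> \<sigma> \<circ> inv' g"
proof -
  let ?O = "\<lambda>p. Orbits.orbit p ` {1..d}"
  have perm: "permutation \<sigma>" "permutation \<tau>"
    using \<sigma> \<tau> by (auto simp: permutation_permutes)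
  have card_range: "card C \<in> {1..d}" if "p permutes {1..d}" "C \<in> ?O p" for p C
  proof -
    have "C \<subseteq> {1..d}" using that(2) permutes_orbit_subset[OF that(1)] by blast
    moreover have "C \<noteq> {}" using that(2) orbit_nonempty[of p] by blast
    ultimately show ?thesis
      using card_mono[of "{1..d}" C] finite_subset[of C "{1..d}"] by (simp add: Suc_le_eq card_gt_0_iff)
  qed
  \<comment> \<open>Distinct cycles are disjoint, so any element of a cycle generates it.\<close>
  have orbitD: "C = Orbits.orbit p c" if "p permutes {1..d}" "C \<in> ?O p" "c \<in> C" for p C c
    using that cyclic_on_orbit[of p "{1..d}"] orbit_cyclic_eq3[of p C c] by auto

  have "\<exists>F. bij_betw F {C \<in> ?O \<sigma>. card C = s} {C \<in> ?O \<tau>. card C = s}" if "s \<in> {1..d}" for s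
    using eq[OF that] by (intro finite_same_card_bij) (auto simp: cycle_count_def)
  then obtain F where F:
    "\<And>s. s \<in> {1..d} \<Longrightarrow> bij_betw (F s) {C \<in> ?O \<sigma>. card C = s} {C \<in> ?O \<tau>. card C = s}"
    using bchoice[of "{1..d}" "\<lambda>s F. bij_betw F {C \<in> ?O \<sigma>. card C = s} {C \<in> ?O \<tau>. card C = s}"]
    by blast
  \<comment> \<open>The bijections for the separate lengths are glued into one map on all cycles. As
    it preserves length, it is injective.\<close>
  define f where "f C = F (card C) C" for C
  have f: "f C \<in> ?O \<tau>" "card (f C) = card C" if "C \<in> ?O \<sigma>" for C
    using bij_betw_apply[OF F[OF card_range[OF \<sigma> that]], of C] that by (auto simp: f_def)
  have f_inj: "C = D" if "C \<in> ?O \<sigma>" "D \<in> ?O \<sigma>" "f C = f D" for C D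
    using that f(2)[of C] f(2)[of D] bij_betw_imp_inj_on[OF F[OF card_range[OF \<sigma> that(1)]]]
    by (auto simp: f_def inj_on_def)

  define r where "r C = (SOME x. x \<in> C)" for C :: "nat set"
  have r: "r C \<in> C" if "C \<in> ?O p" for p C
    unfolding r_def using that orbit_nonempty by (metis imageE some_in_eq)
  \<comment> \<open>The base points \<open>a x\<close> and \<open>b x\<close> depend on
    \<open>x\<close> only through its cycle: they lie in that cycle and in the matched one.\<close>
  define a where "a x = r (Orbits.orbit \<sigma> x)" for x
  define b where "b x = r (f (Orbits.orbit \<sigma> x))" for x
  have orb_a: "Orbits.orbit \<sigma> (a x) = Orbits.orbit \<sigma> x" if "x \<in> {1..d}" for x
    using orbitD[OF \<sigma>, of "Orbits.orbit \<sigma> x" "a x"] r[of "Orbits.orbit \<sigma> x" \<sigma>] that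
    by (auto simp: a_def)
  have orb_b: "Orbits.orbit \<tau> (b x) = f (Orbits.orbit \<sigma> x)" if "x \<in> {1..d}" for x
    using orbitD[OF \<tau> f(1) r[OF f(1)], of "Orbits.orbit \<sigma> x"] that by (auto simp: b_def)
  \<comment> \<open>Matched cycles have the same length, so coincidences of iterates occur for the
    same exponents on both sides. Hence the choice of the exponent \<open>n x\<close> below does not
    affect \<open>g\<close>.\<close>
  have transfer: "(\<sigma> ^^ i) (a x) = (\<sigma> ^^ j) (a x) \<longleftrightarrow> (\<tau> ^^ i) (b x) = (\<tau> ^^ j) (b x)"
    if "x \<in> {1..d}" for x i j
    using that f(2)[of "Orbits.orbit \<sigma> x"]
    by (simp add: funpow_eq_iff_mod_card_orbit perm orb_a orb_b)
  have "\<exists>n. x = (\<sigma> ^^ n) (a x)" if "x \<in> {1..d}" for x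
    using permutation_self_in_orbit[OF perm(1), of x] orb_a[OF that]
      orbit_altdef_permutation[OF perm(1), of "a x"] by auto
  then obtain n where n: "\<And>x. x \<in> {1..d} \<Longrightarrow> x = (\<sigma> ^^ n x) (a x)" by metis

  define g where "g x = (if x \<in> {1..d} then (\<tau> ^^ n x) (b x) else x)" for x
  have g_orbit: "g x \<in> f (Orbits.orbit \<sigma> x)" if "x \<in> {1..d}" for x
    using that orb_b[OF that] orbit_altdef_permutation[OF perm(2), of "b x"]
    by (auto simp: g_def)
  have g_in: "g x \<in> {1..d}" if "x \<in> {1..d}" for x
    using g_orbit[OF that] f(1)[of "Orbits.orbit \<sigma> x"] that permutes_orbit_subset[OF \<tau>] by blast
  have "inj_on g {1..d}"
  proof (rule inj_onI)
    fix x y assume xy: "x \<in> {1..d}" "y \<in> {1..d}" "g x = g y"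
    have "f (Orbits.orbit \<sigma> x) = f (Orbits.orbit \<sigma> y)"
      using xy orbitD[OF \<tau> f(1) g_orbit] by (metis imageI)
    hence "Orbits.orbit \<sigma> x = Orbits.orbit \<sigma> y"
      using xy f_inj by blast
    hence "a x = a y" "b x = b y" by (auto simp: a_def b_def)
    thus "x = y"
      using xy transfer[of x "n x" "n y"] n[of x] n[of y] by (auto simp: g_def)
  qed
  hence "bij_betw g {1..d} {1..d}"
    using g_in by (intro bij_betw_imageI endo_inj_surj) auto
  hence g: "g permutes {1..d}"
    by (rule bij_imp_permutes) (auto simp: g_def)
  have "\<tau> (g x) = g (\<sigma> x)" for x
  proof (cases "x \<in> {1..d}")
    case True
    hence \<sigma>x: "\<sigma> x \<in> {1..d}" using permutes_in_image[OF \<sigma>] by blast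
    have "Orbits.orbit \<sigma> (\<sigma> x) = Orbits.orbit \<sigma> x"
      by (rule permutation_orbit_step[OF perm(1)])
    hence ab: "a (\<sigma> x) = a x" "b (\<sigma> x) = b x" by (auto simp: a_def b_def)
    \<comment> \<open>The exponent \<open>n (\<sigma> x)\<close> may differ from
      \<open>Suc (n x)\<close> by a multiple of the cycle length, so the iterates are compared
      instead of the exponents.\<close>
    have "(\<sigma> ^^ n (\<sigma> x)) (a x) = (\<sigma> ^^ Suc (n x)) (a x)"
      using n[OF \<sigma>x] n[OF True] by (simp add: ab)
    hence "(\<tau> ^^ n (\<sigma> x)) (b x) = (\<tau> ^^ Suc (n x)) (b x)"
      using transfer[OF True] by blast
    thus ?thesis using True \<sigma>x by (simp add: g_def ab)
  next
    case False
    hence "g x = x" "\<sigma> x = x" "\<tau> x = x"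
      using permutes_not_in[OF \<sigma>] permutes_not_in[OF \<tau>] by (auto simp: g_def)
    thus ?thesis by simp
  qed
  hence "\<tau> = g \<circ> \<sigma> \<circ> inv' g"
    by (simp add: fun_eq_iff) (metis g permutes_inverses(1))
  with g show thesis by (rule that)
qed

section \<open>Monomial representations\<close>

text \<open>A finite \<open>G\<close>-set \<open>X\<close> with a cocycle \<open>b\<close>: the group element \<open>g\<close> maps the basis vector
  \<open>e\<^sub>x\<close> to \<open>b g x\<close> times the basis vector of \<open>act g x\<close>.\<close>

locale monomial_action = group G for G (structure) +
  fixes X :: "'x set" and act :: "'g \<Rightarrow> 'x \<Rightarrow> 'x" and b :: "'g \<Rightarrow> 'x \<Rightarrow> 'a::field"
  assumes finite_X: "finite X"
    and act_closed: "\<lbrakk>g \<in> carrier G; x \<in> X\<rbrakk> \<Longrightarrow> act g x \<in> X"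
    and act_one: "x \<in> X \<Longrightarrow> act \<one> x = x"
    and act_mult: "\<lbrakk>g \<in> carrier G; h \<in> carrier G; x \<in> X\<rbrakk> \<Longrightarrow> act (g \<otimes> h) x = act g (act h x)"
    and b_one: "x \<in> X \<Longrightarrow> b \<one> x = 1"
    and b_mult: "\<lbrakk>g \<in> carrier G; h \<in> carrier G; x \<in> X\<rbrakk> \<Longrightarrow> b (g \<otimes> h) x = b g (act h x) * b h x"
begin

text \<open>The trace of \<open>g\<close> in the monomial representation: only fixed points
  contribute to the diagonal.\<close>

definition fixed_sum :: "'g \<Rightarrow> 'a" where
  "fixed_sum g = (\<Sum>x\<in>{x \<in> X. act g x = x}. b g x)"

definition stab :: "'x \<Rightarrow> 'g set" where
  "stab x = {g \<in> carrier G. act g x = x}"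

definition stab_sum :: "'x \<Rightarrow> 'a" where
  "stab_sum x = (\<Sum>g\<in>stab x. b g x)"

section \<open>Stabilizer sums and the weighted orbit count\<close>

lemma act_inv_cancel:
  assumes "g \<in> carrier G" "x \<in> X"
  shows "act (inv g) (act g x) = x"
  using assms by (simp add: act_one flip: act_mult)

text \<open>On the stabilizer of \<open>x\<close> the cocycle law becomes multiplicativity. If
  \<open>b h x \<noteq> 1\<close>, translating the sum by \<open>h\<close> multiplies it by
  \<open>b h x\<close>, which forces it to vanish.\<close>

lemma stab_sum_eq:
  assumes x: "x \<in> X"
  shows "stab_sum x = (if \<forall>g\<in>stab x. b g x = 1 then of_nat (card (stab x)) else 0)"
proof (cases "\<forall>g\<in>stab x. b g x = 1")
  case True
  thus ?thesis by (simp add: stab_sum_def)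
next
  case False
  then obtain h where h: "h \<in> carrier G" "act h x = x" "b h x \<noteq> 1" by (auto simp: stab_def)
  have inv_h: "act (inv h) x = x" using act_inv_cancel[OF h(1) x] h(2) by simp
  have "stab_sum x = (\<Sum>g\<in>stab x. b (h \<otimes> g) x)"
    unfolding stab_sum_def
    by (rule sum.reindex_bij_witness[where i = "\<lambda>g. h \<otimes> g" and j = "\<lambda>g. inv h \<otimes> g"])
       (use h(1,2) inv_h x in \<open>auto simp: stab_def act_mult m_assoc[symmetric]\<close>)
  also have "\<dots> = (\<Sum>g\<in>stab x. b h x * b g x)"
    using x h(1) by (intro sum.cong) (auto simp: stab_def b_mult)
  also have "\<dots> = b h x * stab_sum x"
    by (simp add: stab_sum_def sum_distrib_left)
  finally have "stab_sum x = 0" using h(3) by simp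
  thus ?thesis by (simp only: False if_False)
qed

text \<open>Conjugation by \<open>h\<close> maps the stabilizer of \<open>x\<close> onto that of
  \<open>act h x\<close>. It preserves the values of \<open>b\<close>, since the contributions of
  \<open>h\<close> and its inverse cancel.\<close>

lemma stab_sum_act:
  assumes x: "x \<in> X" and h: "h \<in> carrier G"
  shows "stab_sum (act h x) = stab_sum x"
proof -
  have hx: "act h x \<in> X" using h x by (rule act_closed)
  have b_inv: "b h x * b (inv h) (act h x) = 1"
    using h hx x b_mult[of h "inv h" "act h x"] by (simp add: act_inv_cancel b_one)
  have conj: "act (h \<otimes> g \<otimes> inv h) (act h x) = act h x \<and>
      b (h \<otimes> g \<otimes> inv h) (act h x) = b g x" if "g \<in> stab x" for g
    using that h hx x b_inv by (simp add: stab_def act_mult b_mult act_inv_cancel)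
  have conj': "act (inv h \<otimes> g \<otimes> h) x = x" if "g \<in> stab (act h x)" for g
    using that h x hx by (simp add: stab_def act_mult act_inv_cancel)
  have cancel: "h \<otimes> (inv h \<otimes> g \<otimes> h) \<otimes> inv h = g" "inv h \<otimes> (h \<otimes> g \<otimes> inv h) \<otimes> h = g"
    if "g \<in> carrier G" for g
    using that h by (simp_all add: m_assoc) (simp_all add: m_assoc[symmetric])
  show ?thesis
    unfolding stab_sum_def
    by (rule sum.reindex_bij_witness[symmetric, where
          j = "\<lambda>g. h \<otimes> g \<otimes> inv h" and i = "\<lambda>g. inv h \<otimes> g \<otimes> h"])
       (use h conj conj' cancel in \<open>auto simp: stab_def\<close>)
qed

text \<open>The group elements that move \<open>x\<close> to \<open>act h x\<close> form the coset
  of the stabilizer represented by \<open>h\<close>, so all fibres over the orbit have equal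
  size.\<close>

lemma card_orbit_stab:
  assumes x: "x \<in> X" and fin: "finite (carrier G)"
  shows "card (orbit G act x) * card (stab x) = order G"
proof -
  have orbit: "orbit G act x = (\<lambda>g. act g x) ` carrier G" by (auto simp: orbit_def)
  have fibre: "card {g \<in> carrier G. act g x = y} = card (stab x)" if y: "y \<in> orbit G act x" for y
  proof -
    obtain h where h: "h \<in> carrier G" "y = act h x" using y by (auto simp: orbit_def)
    have "bij_betw (\<lambda>g. h \<otimes> g) (stab x) {g \<in> carrier G. act g x = y}"
      by (rule bij_betwI[where g = "\<lambda>g. inv h \<otimes> g"])
         (use h x in \<open>auto simp: stab_def act_mult act_inv_cancel m_assoc[symmetric]\<close>)
    thus ?thesis by (simp add: bij_betw_same_card)
  qed
  have "order G = (\<Sum>y\<in>orbit G act x. card {g \<in> carrier G. act g x = y})"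
    using sum.image_gen[OF fin, of "\<lambda>_. 1::nat" "\<lambda>g. act g x"] by (simp add: order_def orbit)
  thus ?thesis using fibre by simp
qed

lemma orbit_eqI:
  assumes "x \<in> X" "y \<in> orbit G act x"
  shows "orbit G act y = orbit G act x"
proof -
  obtain h where h: "h \<in> carrier G" "y = act h x" using assms by (auto simp: orbit_def)
  have "act g y = act (g \<otimes> h) x" "act g x = act (g \<otimes> inv h) y" if "g \<in> carrier G" for g
    using that h assms(1) by (simp_all add: act_mult act_closed act_inv_cancel)
  thus ?thesis using h(1) unfolding orbit_def by blast
qed

text \<open>A weighted Burnside lemma: the sum over pairs of a group element and a point fixed by it
  is reordered by points, then grouped into orbits, along which \<open>stab_sum\<close> is
  constant.\<close>

theorem sum_fixed_sum:
  assumes fin: "finite (carrier G)"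
    and T: "T \<subseteq> X" "\<And>C. C \<in> orbits G X act \<Longrightarrow> \<exists>!t. t \<in> T \<inter> C"
  shows "(\<Sum>g\<in>carrier G. fixed_sum g) =
    of_nat (order G) * of_nat (card {t \<in> T. \<forall>g\<in>stab t. b g t = 1})"
proof -
  let ?orb = "orbit G act"
  have orb_refl: "x \<in> ?orb x" if "x \<in> X" for x
    using act_one[OF that] by (force simp: orbit_def)
  have orb_sub: "?orb x \<subseteq> X" if "x \<in> X" for x
    using that act_closed by (auto simp: orbit_def)
  have finT: "finite T" using T(1) finite_X by (rule finite_subset)
  have "X = (\<Union>t\<in>T. ?orb t)"
  proof (intro equalityI subsetI)
    fix x assume x: "x \<in> X"
    hence "?orb x \<in> orbits G X act" by (auto simp: orbits_def)
    then obtain t where "t \<in> T" "t \<in> ?orb x" using T(2) by (metis IntE)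
    with x orb_refl orbit_eqI[OF x] show "x \<in> (\<Union>t\<in>T. ?orb t)" by blast
  qed (use orb_sub T(1) in blast)
  hence "(\<Sum>x\<in>X. stab_sum x) = (\<Sum>x\<in>(\<Union>t\<in>T. ?orb t). stab_sum x)" by simp
  also have "\<dots> = (\<Sum>t\<in>T. \<Sum>x\<in>?orb t. stab_sum x)"
  proof (rule sum.UNION_disjoint)
    show "\<forall>t\<in>T. finite (?orb t)" using orb_sub T(1) finite_X by (meson finite_subset subsetD)
    show "\<forall>t\<in>T. \<forall>t'\<in>T. t \<noteq> t' \<longrightarrow> ?orb t \<inter> ?orb t' = {}"
    proof (intro ballI impI, rule ccontr)
      fix t t' assume t: "t \<in> T" "t' \<in> T" "t \<noteq> t'" "?orb t \<inter> ?orb t' \<noteq> {}"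
      then obtain x where "x \<in> ?orb t" "x \<in> ?orb t'" by blast
      hence "?orb t = ?orb t'" using t T(1) orbit_eqI by (metis subsetD)
      hence "t \<in> T \<inter> ?orb t" "t' \<in> T \<inter> ?orb t"
        using t T(1) orb_refl by auto
      moreover have "?orb t \<in> orbits G X act" using t T(1) by (auto simp: orbits_def)
      ultimately show False using T(2) t(3) by blast
    qed
  qed (rule finT)
  also have "\<dots> = (\<Sum>t\<in>T. of_nat (card (?orb t)) * stab_sum t)"
  proof (rule sum.cong[OF refl])
    fix t assume "t \<in> T"
    hence "(\<Sum>x\<in>?orb t. stab_sum x) = (\<Sum>x\<in>?orb t. stab_sum t)"
      using T(1) stab_sum_act by (intro sum.cong) (auto simp: orbit_def)
    thus "(\<Sum>x\<in>?orb t. stab_sum x) = of_nat (card (?orb t)) * stab_sum t" by simp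
  qed
  \<comment> \<open>Where the character is trivial, orbit size times stabilizer order is the group
    order; elsewhere the stabilizer sum is 0.\<close>
  also have "\<dots> = (\<Sum>t\<in>T. if \<forall>g\<in>stab t. b g t = 1 then of_nat (order G) else 0)"
    using T(1) card_orbit_stab[OF _ fin] stab_sum_eq
    by (intro sum.cong) (auto simp: subset_iff simp flip: of_nat_mult)
  also have "\<dots> = (\<Sum>t\<in>{t \<in> T. \<forall>g\<in>stab t. b g t = 1}. of_nat (order G))"
    using finT by (intro sum.inter_filter[symmetric])
  also have "\<dots> = of_nat (order G) * of_nat (card {t \<in> T. \<forall>g\<in>stab t. b g t = 1})"
    by (simp add: mult.commute)
  finally have "(\<Sum>x\<in>X. stab_sum x) = \<dots>" .
  moreover have "(\<Sum>g\<in>carrier G. fixed_sum g) = (\<Sum>x\<in>X. stab_sum x)"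
    unfolding fixed_sum_def stab_sum_def stab_def
    using fin finite_X by (rule sum.swap_restrict)
  ultimately show ?thesis by simp
qed

section \<open>Monomial matrices and their traces\<close>

definition monomial_mat :: "(nat \<Rightarrow> 'x) \<Rightarrow> 'g \<Rightarrow> 'a mat" where
  "monomial_mat f g = mat (card X) (card X)
     (\<lambda>(i, j). if f i = act g (f j) then b g (f j) else 0)"

context
  fixes f
  assumes f: "bij_betw f {0..<card X} X"
begin

lemma f_in: "i < card X \<Longrightarrow> f i \<in> X"
  using bij_betw_apply[OF f] by simp

lemma monomial_mat_one: "monomial_mat f \<one> = 1\<^sub>m (card X)"
proof (rule eq_matI)
  fix i j assume ij: "i < dim_row (1\<^sub>m (card X))" "j < dim_col (1\<^sub>m (card X))"
  hence "f i = f j \<longleftrightarrow> i = j"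
    using inj_on_eq_iff[OF bij_betw_imp_inj_on[OF f], of i j] by simp
  thus "monomial_mat f \<one> $$ (i, j) = 1\<^sub>m (card X) $$ (i, j)"
    using ij f_in by (simp add: monomial_mat_def act_one b_one)
qed (auto simp: monomial_mat_def)

lemma monomial_mat_mult:
  assumes g: "g \<in> carrier G" and h: "h \<in> carrier G"
  shows "monomial_mat f (g \<otimes> h) = monomial_mat f g * monomial_mat f h"
proof (rule eq_matI)
  fix i j assume "i < dim_row (monomial_mat f g * monomial_mat f h)"
    "j < dim_col (monomial_mat f g * monomial_mat f h)"
  hence ij: "i < card X" "j < card X" by (auto simp: monomial_mat_def)
  let ?e = "\<lambda>x. if f i = act g x then b g x else 0"
  have "(monomial_mat f g * monomial_mat f h) $$ (i, j) =
      (\<Sum>l\<in>{0..<card X}. ?e (f l) * (if f l = act h (f j) then b h (f j) else 0))"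
    using ij by (simp add: monomial_mat_def scalar_prod_def)
  also have "\<dots> = (\<Sum>x\<in>X. ?e x * (if x = act h (f j) then b h (f j) else 0))"
    by (rule sum.reindex_bij_betw[OF f])
  \<comment> \<open>Column \<open>j\<close> of the right factor vanishes off the row of
    \<open>act h (f j)\<close>, so one term remains and the cocycle law evaluates it.\<close>
  also have "\<dots> = (\<Sum>x\<in>X. if x = act h (f j) then ?e x * b h (f j) else 0)"
    by (intro sum.cong) auto
  also have "\<dots> = ?e (act h (f j)) * b h (f j)"
    using finite_X act_closed[OF h f_in[OF ij(2)]] by simp
  also have "\<dots> = monomial_mat f (g \<otimes> h) $$ (i, j)"
    using ij g h f_in by (simp add: monomial_mat_def act_mult b_mult)
  finally show "monomial_mat f (g \<otimes> h) $$ (i, j) = (monomial_mat f g * monomial_mat f h) $$ (i, j)"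
    by simp
qed (auto simp: monomial_mat_def)

lemma monomial_mat_hom: "monomial_mat f \<in> hom G (GL (card X))"
proof (rule homI)
  fix g assume g: "g \<in> carrier G"
  have "monomial_mat f h \<in> carrier_mat (card X) (card X)" for h
    by (simp add: monomial_mat_def)
  moreover have "monomial_mat f g * monomial_mat f (inv g) = 1\<^sub>m (card X)"
    "monomial_mat f (inv g) * monomial_mat f g = 1\<^sub>m (card X)"
    using g by (simp_all add: monomial_mat_one flip: monomial_mat_mult)
  ultimately show "monomial_mat f g \<in> carrier (GL (card X))"
    by (auto simp: GL_def units_of_def Units_def ring_mat_def)
qed (simp add: monomial_mat_mult GL_def units_of_def ring_mat_def)

lemma trace_monomial_mat: "(\<Sum>i<card X. monomial_mat f g $$ (i, i)) = fixed_sum g"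
proof -
  have "(\<Sum>i<card X. monomial_mat f g $$ (i, i)) =
      (\<Sum>i\<in>{0..<card X}. if act g (f i) = f i then b g (f i) else 0)"
    by (intro sum.cong) (auto simp: monomial_mat_def)
  also have "\<dots> = (\<Sum>x\<in>X. if act g x = x then b g x else 0)"
    by (rule sum.reindex_bij_betw[OF f])
  also have "\<dots> = fixed_sum g"
    unfolding fixed_sum_def using finite_X by (rule sum.inter_filter[symmetric])
  finally show ?thesis .
qed

end

end

text \<open>The monomial matrices realize this function as a trace; the value 0 off the group is the
  normalization in \<open>characters\<close>.\<close>

lemma fixed_sum_in_characters:
  assumes "monomial_action (sym_group d) X act b"
  shows "(\<lambda>\<sigma>. if \<sigma> \<in> carrier (sym_group d) then monomial_action.fixed_sum X act b \<sigma> else 0)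
    \<in> characters d"
proof -
  interpret monomial_action "sym_group d" X act b by fact
  obtain f where f: "bij_betw f {0..<card X} X"
    using ex_bij_betw_nat_finite[OF finite_X] by blast
  show ?thesis
    unfolding characters_def
    using monomial_mat_hom[OF f] trace_monomial_mat[OF f]
    by (intro CollectI exI[of _ "card X"] bexI[of _ "monomial_mat f"]) auto
qed

section \<open>Tensor products of monomial representations\<close>

lemma monomial_action_PiE:
  assumes "group G" and fin: "finite A"
    and act: "\<And>m. m \<in> A \<Longrightarrow> monomial_action G (X m) (act m) (b m)"
  shows "monomial_action G (PiE A X) (\<lambda>g \<omega>. \<lambda>m\<in>A. act m g (\<omega> m))
    (\<lambda>g \<omega>. \<Prod>m\<in>A. b m g (\<omega> m))"
proof -
  interpret group G by fact
  note ax = monomial_action.act_closed[OF act] monomial_action.act_one[OF act]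
    monomial_action.act_mult[OF act] monomial_action.b_one[OF act] monomial_action.b_mult[OF act]
  show ?thesis
  proof unfold_locales
    show "finite (PiE A X)"
      using fin monomial_action.finite_X[OF act] by (intro finite_PiE)
  next
    fix \<omega> assume "\<omega> \<in> PiE A X"
    thus "(\<lambda>m\<in>A. act m \<one>\<^bsub>G\<^esub> (\<omega> m)) = \<omega>"
      by (auto simp: fun_eq_iff ax PiE_mem)
  qed (auto simp: ax PiE_mem prod.distrib intro!: restrict_ext prod.neutral prod.cong)
qed

text \<open>A tuple is fixed exactly when all its components are, so expanding the product of the
  sums gives one term for each fixed tuple.\<close>

lemma fixed_sum_PiE:
  assumes "group G" and fin: "finite A"
    and act: "\<And>m. m \<in> A \<Longrightarrow> monomial_action G (X m) (act m) (b m)"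
  shows "monomial_action.fixed_sum (PiE A X) (\<lambda>g \<omega>. \<lambda>m\<in>A. act m g (\<omega> m))
      (\<lambda>g \<omega>. \<Prod>m\<in>A. b m g (\<omega> m)) g =
    (\<Prod>m\<in>A. monomial_action.fixed_sum (X m) (act m) (b m) g)"
proof -
  have "{\<omega> \<in> PiE A X. (\<lambda>m\<in>A. act m g (\<omega> m)) = \<omega>} = (\<Pi>\<^sub>E m\<in>A. {x \<in> X m. act m g x = x})"
    by (auto simp: PiE_iff fun_eq_iff extensional_def restrict_def)
  moreover have "(\<Prod>m\<in>A. monomial_action.fixed_sum (X m) (act m) (b m) g) =
      (\<Prod>m\<in>A. \<Sum>x\<in>{x \<in> X m. act m g x = x}. b m g x)"
    using monomial_action.fixed_sum_def[OF act] by simp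
  ultimately show ?thesis
    using fin monomial_action.finite_X[OF act]
    by (simp add: monomial_action.fixed_sum_def[OF monomial_action_PiE[OF assms]] prod_sum_PiE)
qed

section \<open>Injectivity of the characteristic map\<close>

definition cycle_exponents :: "nat \<Rightarrow> (nat \<Rightarrow> nat) \<Rightarrow> (nat \<Rightarrow>\<^sub>0 nat)" where
  "cycle_exponents d \<sigma> = (\<Sum>s = 1..d. Poly_Mapping.single s (cycle_count d \<sigma> s))"

lemma lookup_cycle_exponents:
  "Poly_Mapping.lookup (cycle_exponents d \<sigma>) s = (if s \<in> {1..d} then cycle_count d \<sigma> s else 0)"
  by (simp add: cycle_exponents_def lookup_sum lookup_single when_def)

lemma keys_cycle_exponents: "Poly_Mapping.keys (cycle_exponents d \<sigma>) \<subseteq> {1..d}"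
  by (auto simp: in_keys_iff lookup_cycle_exponents split: if_splits)

lemma cycle_monomial_eq:
  "cycle_monomial d \<sigma> = (\<Prod>s\<in>Poly_Mapping.keys (cycle_exponents d \<sigma>).
     power_sum s ^ Poly_Mapping.lookup (cycle_exponents d \<sigma>) s)"
proof -
  have "cycle_monomial d \<sigma> =
      (\<Prod>s = 1..d. power_sum s ^ Poly_Mapping.lookup (cycle_exponents d \<sigma>) s)"
    by (simp add: cycle_monomial_def lookup_cycle_exponents)
  also have "\<dots> = (\<Prod>s\<in>Poly_Mapping.keys (cycle_exponents d \<sigma>).
     power_sum s ^ Poly_Mapping.lookup (cycle_exponents d \<sigma>) s)"
    by (rule prod.mono_neutral_right)
       (use keys_cycle_exponents in \<open>auto simp: in_keys_iff\<close>)
  finally show ?thesis .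
qed

definition ch_poly ::
    "nat \<Rightarrow> ((nat \<Rightarrow> nat) \<Rightarrow> 'a::field_char_0) \<Rightarrow> ((nat \<Rightarrow>\<^sub>0 nat) \<Rightarrow>\<^sub>0 'a)" where
  "ch_poly d u = (\<Sum>\<sigma>\<in>carrier (sym_group d).
     Poly_Mapping.single (cycle_exponents d \<sigma>) (u \<sigma> / of_nat (fact d)))"

lemma ch_eq_eval_power_sums: "ch d u = eval_power_sums (ch_poly d u)"
proof -
  have "xconst (u \<sigma> / of_nat (fact d)) = xconst (1 / of_nat (fact d)) * xconst (u \<sigma>)" for \<sigma>
    by (simp flip: xconst_mult)
  thus ?thesis
    unfolding ch_def ch_poly_def eval_power_sums_sum eval_power_sums_single
    by (simp add: sum_distrib_left cycle_monomial_eq mult.assoc)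
qed

lemma keys_ch_poly:
  assumes "m \<in> Poly_Mapping.keys (ch_poly d u)"
  shows "Poly_Mapping.keys m \<subseteq> {1..d}"
proof -
  have "\<exists>\<sigma>. m = cycle_exponents d \<sigma>"
  proof (rule ccontr)
    assume "\<nexists>\<sigma>. m = cycle_exponents d \<sigma>"
    hence "Poly_Mapping.lookup (ch_poly d u) m = 0"
      by (auto simp: ch_poly_def lookup_sum lookup_single when_def intro!: sum.neutral)
    with assms show False by (simp add: in_keys_iff)
  qed
  thus ?thesis using keys_cycle_exponents by auto
qed

text \<open>Algebraic independence identifies \<open>power_sum_poly\<close> with
  \<open>ch_poly\<close>. There each permutation contributes its coefficient to the total, whatever
  its cycle type.\<close>

lemma coeff_sum_ch: "coeff_sum d (ch d u) = (\<Sum>\<sigma>\<in>carrier (sym_group d). u \<sigma>) / of_nat (fact d)"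
proof -
  have "power_sum_poly d (ch d u) = ch_poly d u"
    unfolding ch_eq_eval_power_sums by (rule power_sum_poly_eval) (rule keys_ch_poly)
  hence "coeff_sum d (ch d u) = coeff_total (ch_poly d u)"
    by (simp add: coeff_sum_def coeff_total_def)
  thus ?thesis
    by (simp add: ch_poly_def coeff_total_sum coeff_total_single sum_divide_distrib)
qed

section \<open>Class functions and injectivity of the characteristic map\<close>

lemma finite_sym_group: "finite (carrier (sym_group d))"
  by (simp add: sym_group_def finite_permutations)

lemma order_sym_group: "order (sym_group d) = fact d"
  using card_permutations[of "{1..d}" d] by (simp add: order_def sym_group_def)

text \<open>The trace of a product of two matrices is unchanged when they are swapped; here the two
  factors are the images of \<open>g \<circ> p\<close> and of \<open>inv' g\<close>.\<close>

lemma characters_conj: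
  assumes u: "u \<in> characters d"
    and g: "g \<in> carrier (sym_group d)" and p: "p \<in> carrier (sym_group d)"
  shows "u (g \<circ> p \<circ> inv' g) = u p"
proof -
  obtain n \<rho> where \<rho>: "\<rho> \<in> hom (sym_group d) (GL n)"
    and u_eq: "u = (\<lambda>\<sigma>. if \<sigma> \<in> carrier (sym_group d) then (\<Sum>i<n. \<rho> \<sigma> $$ (i, i)) else 0)"
    using u unfolding characters_def by blast
  have carr: "\<rho> x \<in> carrier_mat n n" if "x permutes {1..d}" for x
    using hom_in_carrier[OF \<rho>, of x] that
    by (auto simp: GL_def units_of_def Units_def ring_mat_def sym_group_carrier)
  have mult: "\<rho> (x \<circ> y) = \<rho> x * \<rho> y" if "x permutes {1..d}" "y permutes {1..d}" for x y
    using hom_mult[OF \<rho>, of x y] that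
    by (simp add: GL_def units_of_def ring_mat_def sym_group_carrier sym_group_mult)
  have trace_comm: "(\<Sum>i<n. (A * B) $$ (i, i)) = (\<Sum>i<n. (B * A) $$ (i, i))"
    if "A \<in> carrier_mat n n" "B \<in> carrier_mat n n" for A B :: "'a mat"
  proof -
    have "(\<Sum>i<n. (A * B) $$ (i, i)) = (\<Sum>i<n. \<Sum>j<n. A $$ (i, j) * B $$ (j, i))"
      using that by (intro sum.cong) (auto simp: scalar_prod_def lessThan_atLeast0)
    also have "\<dots> = (\<Sum>j<n. \<Sum>i<n. B $$ (j, i) * A $$ (i, j))"
      by (subst sum.swap) (simp add: mult.commute)
    also have "\<dots> = (\<Sum>i<n. (B * A) $$ (i, i))"
      using that by (intro sum.cong) (auto simp: scalar_prod_def lessThan_atLeast0)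
    finally show ?thesis .
  qed
  have perm: "g permutes {1..d}" "p permutes {1..d}" "inv' g permutes {1..d}"
    using g p by (simp_all add: sym_group_carrier permutes_inv)
  have "(\<Sum>i<n. \<rho> (g \<circ> p \<circ> inv' g) $$ (i, i)) = (\<Sum>i<n. (\<rho> (g \<circ> p) * \<rho> (inv' g)) $$ (i, i))"
    using perm by (simp add: mult permutes_compose)
  also have "\<dots> = (\<Sum>i<n. (\<rho> (inv' g) * \<rho> (g \<circ> p)) $$ (i, i))"
    using perm by (intro trace_comm carr permutes_compose)
  also have "\<dots> = (\<Sum>i<n. \<rho> (inv' g \<circ> (g \<circ> p)) $$ (i, i))"
    using perm by (simp add: mult permutes_compose)
  also have "inv' g \<circ> (g \<circ> p) = p"
    using perm by (simp add: permutes_inv_o flip: comp_assoc)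
  finally have trace: "(\<Sum>i<n. \<rho> (g \<circ> p \<circ> inv' g) $$ (i, i)) = (\<Sum>i<n. \<rho> p $$ (i, i))" .
  have "g \<circ> p \<circ> inv' g \<in> carrier (sym_group d)"
    using perm by (simp only: sym_group_carrier permutes_compose)
  with p trace show ?thesis by (simp only: u_eq if_True)
qed

lemma virtual_characters_conj:
  assumes "u \<in> virtual_characters d"
    and "g \<in> carrier (sym_group d)" "p \<in> carrier (sym_group d)"
  shows "u (g \<circ> p \<circ> inv' g) = u p"
proof -
  obtain a b where "a \<in> characters d" "b \<in> characters d" and u: "u = (\<lambda>\<sigma>. a \<sigma> - b \<sigma>)"
    using assms(1) by (auto simp: virtual_characters_def)
  hence "a (g \<circ> p \<circ> inv' g) = a p" "b (g \<circ> p \<circ> inv' g) = b p"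
    using assms(2,3) by (simp_all only: characters_conj)
  thus ?thesis by (simp only: u)
qed

lemma virtual_characters_outside:
  assumes "u \<in> virtual_characters d" "\<sigma> \<notin> carrier (sym_group d)"
  shows "u \<sigma> = 0"
  using assms by (auto simp: virtual_characters_def characters_def)

lemma characters_subset_virtual_characters: "characters d \<subseteq> virtual_characters d"
proof
  fix u :: "(nat \<Rightarrow> nat) \<Rightarrow> 'a" assume u: "u \<in> characters d"
  \<comment> \<open>The empty set gives the representation of dimension 0, hence the zero character
    to be subtracted.\<close>
  have empty: "monomial_action (sym_group d) ({} :: nat set) (\<lambda>_ x. x) (\<lambda>_ _. 1 :: 'a)"
    by (intro monomial_action.intro monomial_action_axioms.intro sym_group_is_group) auto
  have "(\<lambda>_. 0) \<in> (characters d :: ((nat \<Rightarrow> nat) \<Rightarrow> 'a) set)"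
    using fixed_sum_in_characters[OF empty] monomial_action.fixed_sum_def[OF empty]
    by (simp cong: if_cong)
  with u show "u \<in> virtual_characters d"
    unfolding virtual_characters_def by force
qed

text \<open>The coefficient of \<open>ch_poly\<close> at a cycle type is the value of the class
  function times a nonzero factor that depends on the cycle type only, so the values can be read
  off.\<close>

lemma inj_on_ch: "inj_on (ch d) (virtual_characters d :: ((nat \<Rightarrow> nat) \<Rightarrow> 'a::field_char_0) set)"
proof (rule inj_onI)
  fix u v :: "(nat \<Rightarrow> nat) \<Rightarrow> 'a"
  assume uv: "u \<in> virtual_characters d" "v \<in> virtual_characters d" "ch d u = ch d v"
  have zero: "0 \<notin> Poly_Mapping.keys m" if "Poly_Mapping.keys m \<subseteq> {1..d}" for m :: "nat \<Rightarrow>\<^sub>0 nat"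
    using that by auto
  have poly: "ch_poly d u = ch_poly d v"
    using uv(3) zero keys_ch_poly unfolding ch_eq_eval_power_sums
    by (intro eval_power_sums_inject) blast+
  show "u = v"
  proof
    fix \<tau>
    show "u \<tau> = v \<tau>"
    proof (cases "\<tau> \<in> carrier (sym_group d)")
      case False
      thus ?thesis using uv virtual_characters_outside by metis
    next
      case \<tau>: True
      let ?C = "{\<sigma> \<in> carrier (sym_group d). cycle_exponents d \<sigma> = cycle_exponents d \<tau>}"
      \<comment> \<open>Equal cycle type makes the elements of \<open>?C\<close> conjugate to
        \<open>\<tau>\<close>, and virtual characters are constant under conjugation.\<close>
      have const: "w \<sigma> = w \<tau>" if w: "w \<in> virtual_characters d" and \<sigma>: "\<sigma> \<in> ?C"
        for w :: "(nat \<Rightarrow> nat) \<Rightarrow> 'a" and \<sigma>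
      proof -
        have "cycle_count d \<tau> s = cycle_count d \<sigma> s" if "s \<in> {1..d}" for s
          using \<sigma> that lookup_cycle_exponents by (metis (mono_tags, lifting) mem_Collect_eq)
        then obtain g where g: "g permutes {1..d}" "\<sigma> = g \<circ> \<tau> \<circ> inv' g"
          using \<sigma> \<tau> conj_if_cycle_count_eq[of \<tau> d \<sigma>] by (auto simp: sym_group_carrier)
        thus ?thesis
          using virtual_characters_conj[OF w _ \<tau>] by (simp add: sym_group_carrier)
      qed
      have lookup: "Poly_Mapping.lookup (ch_poly d w) (cycle_exponents d \<tau>) =
          of_nat (card ?C) * (w \<tau> / of_nat (fact d))"
        if w: "w \<in> virtual_characters d" for w :: "(nat \<Rightarrow> nat) \<Rightarrow> 'a"
      proof -
        have "Poly_Mapping.lookup (ch_poly d w) (cycle_exponents d \<tau>) =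
            (\<Sum>\<sigma>\<in>?C. w \<sigma> / of_nat (fact d))"
          by (simp add: ch_poly_def lookup_sum lookup_single when_def finite_sym_group
                flip: sum.inter_filter)
        also have "\<dots> = (\<Sum>\<sigma>\<in>?C. w \<tau> / of_nat (fact d))"
          using const[OF w] by (intro sum.cong) auto
        finally show ?thesis by simp
      qed
      have "finite ?C" "\<tau> \<in> ?C" using \<tau> finite_sym_group by auto
      hence "card ?C \<noteq> 0" by (metis card_0_eq empty_iff)
      thus ?thesis
        using lookup[OF uv(1)] lookup[OF uv(2)] poly by simp
    qed
  qed
qed

section \<open>The internal product on images of virtual characters\<close>

lemma internal_prod_ch:
  assumes "u \<in> virtual_characters d" "v \<in> virtual_characters d"
  shows "internal_prod d (ch d u) (ch d v) = ch d (\<lambda>\<sigma>. u \<sigma> * v \<sigma>)"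
  using assms by (simp add: internal_prod_def inv_into_f_f[OF inj_on_ch])

text \<open>Each stage of the fold applies \<open>inv_into\<close> to the preceding partial product,
  so all partial products are required to be virtual characters.\<close>

lemma internal_prod_family_ch:
  assumes "k \<ge> 1"
    and A: "\<And>m. m \<in> {1..k} \<Longrightarrow> A m = ch d (u m)"
    and u: "\<And>m. m \<in> {1..k} \<Longrightarrow> u m \<in> virtual_characters d"
    and prod: "\<And>j. j \<in> {1..k} \<Longrightarrow> (\<lambda>\<sigma>. \<Prod>m = 1..j. u m \<sigma>) \<in> virtual_characters d"
  shows "internal_prod_family d k A = ch d (\<lambda>\<sigma>. \<Prod>m = 1..k. u m \<sigma>)"
proof -
  have "foldl (internal_prod d) (A 1) (map A [2..<Suc j]) = ch d (\<lambda>\<sigma>. \<Prod>m = 1..j. u m \<sigma>)"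
    if "1 \<le> j" "j \<le> k" for j
    using that
  proof (induction j rule: dec_induct)
    \<comment> \<open>For one factor the list \<open>[2..<2]\<close> is empty and the fold returns
      its start value \<open>A 1\<close>.\<close>
    case base
    thus ?case using A[of 1] by simp
  next
    case (step j)
    hence "foldl (internal_prod d) (A 1) (map A [2..<Suc (Suc j)]) =
        internal_prod d (ch d (\<lambda>\<sigma>. \<Prod>m = 1..j. u m \<sigma>)) (ch d (u (Suc j)))"
      using A[of "Suc j"] by simp
    also have "\<dots> = ch d (\<lambda>\<sigma>. (\<Prod>m = 1..j. u m \<sigma>) * u (Suc j) \<sigma>)"
      using step by (intro internal_prod_ch prod u) auto
    finally show ?case using step by (simp add: mult.commute)
  qed
  from this[of k] assms(1) show ?thesis by (simp add: internal_prod_family_def)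
qed

section \<open>Transversals\<close>

text \<open>The inverse stays the group operation here, so that the general group laws apply to
  it.\<close>

declare sym_group_inv_equality [simp del]

text \<open>A subgroup contains an element together with its inverse; this puts coset membership
  into the shape of the condition in \<open>transversal_action\<close>.\<close>

lemma (in group) mem_l_coset_iff:
  assumes H: "subgroup H G" and "x \<in> carrier G" "y \<in> carrier G"
  shows "y \<in> x <# H \<longleftrightarrow> inv y \<otimes> x \<in> H"
proof -
  have "y \<in> x <# H \<longleftrightarrow> inv x \<otimes> y \<in> H"
    using subgroup.lcos_module_imp[OF H group_axioms assms(2)]
      subgroup.lcos_module_rev[OF H group_axioms assms(2,3)] by blast
  also have "\<dots> \<longleftrightarrow> inv y \<otimes> x \<in> H"
    using subgroup.m_inv_closed[OF H, of "inv x \<otimes> y"]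
      subgroup.m_inv_closed[OF H, of "inv y \<otimes> x"] assms
    by (auto simp: inv_mult_group)
  finally show ?thesis .
qed

lemma cycle_monomial_conj:
  assumes "g \<in> carrier (sym_group d)" "p \<in> carrier (sym_group d)"
  shows "cycle_monomial d (g \<otimes>\<^bsub>sym_group d\<^esub> p \<otimes>\<^bsub>sym_group d\<^esub> inv\<^bsub>sym_group d\<^esub> g) =
    cycle_monomial d p"
  using assms cycle_count_conj[of g d p]
  by (simp add: cycle_monomial_def sym_group_mult sym_group_inv_equality sym_group_carrier)

lemma one_dim_character_mult:
  assumes "one_dim_character d W \<chi>" "v \<in> W" "w \<in> W"
  shows "\<chi> (v \<otimes>\<^bsub>sym_group d\<^esub> w) = \<chi> v * \<chi> w"
  using assms by (auto simp: one_dim_character_def field_units_def hom_def)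

lemma one_dim_character_one:
  assumes "one_dim_character d W \<chi>" "subgroup W (sym_group d)"
  shows "\<chi> \<one>\<^bsub>sym_group d\<^esub> = 1"
proof -
  interpret group "sym_group d" by (rule sym_group_is_group)
  have one: "\<one>\<^bsub>sym_group d\<^esub> \<in> W" using assms(2) by (rule subgroup.one_closed)
  hence "\<chi> \<one>\<^bsub>sym_group d\<^esub> \<noteq> 0"
    using assms(1) by (auto simp: one_dim_character_def field_units_def hom_def)
  with one_dim_character_mult[OF assms(1) one one] show ?thesis by simp
qed

section \<open>The induced character of a one-dimensional character\<close>

definition transversal_cocycle ::
    "nat \<Rightarrow> (nat \<Rightarrow> nat) set \<Rightarrow> (nat \<Rightarrow> nat) set \<Rightarrow> ((nat \<Rightarrow> nat) \<Rightarrow> 'a) \<Rightarrow>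
     (nat \<Rightarrow> nat) \<Rightarrow> (nat \<Rightarrow> nat) \<Rightarrow> 'a" where
  "transversal_cocycle d W J \<chi> \<zeta> i =
     \<chi> (inv\<^bsub>sym_group d\<^esub> (transversal_action d W J \<zeta> i) \<otimes>\<^bsub>sym_group d\<^esub> \<zeta> \<otimes>\<^bsub>sym_group d\<^esub> i)"

text \<open>The Frobenius formula over a transversal: the fixed \<open>i\<close> are those whose
  conjugate of \<open>\<sigma>\<close> by \<open>i\<close> falls into \<open>W\<close>, and
  \<open>\<chi>\<close> is evaluated at that conjugate.\<close>

definition induced_character ::
    "nat \<Rightarrow> (nat \<Rightarrow> nat) set \<Rightarrow> (nat \<Rightarrow> nat) set \<Rightarrow> ((nat \<Rightarrow> nat) \<Rightarrow> 'a::field) \<Rightarrow>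
     (nat \<Rightarrow> nat) \<Rightarrow> 'a" where
  "induced_character d W J \<chi> \<sigma> = (if \<sigma> \<in> carrier (sym_group d) then
     monomial_action.fixed_sum J (transversal_action d W J) (transversal_cocycle d W J \<chi>) \<sigma> else 0)"

context
  fixes d :: nat and W J :: "(nat \<Rightarrow> nat) set"
  assumes W: "subgroup W (sym_group d)" and J: "left_transversal d W J"
begin

interpretation G: group "sym_group d" by (rule sym_group_is_group)

lemma transversal_carrier: "j \<in> J \<Longrightarrow> j \<in> carrier (sym_group d)"
  using J by (auto simp: left_transversal_def)

lemma finite_transversal: "finite J"
  using J finite_sym_group finite_subset by (auto simp: left_transversal_def)

lemma transversal_unique:
  assumes "x \<in> carrier (sym_group d)"
  shows "\<exists>!j. j \<in> J \<and> inv\<^bsub>sym_group d\<^esub> j \<otimes>\<^bsub>sym_group d\<^esub> x \<in> W"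
proof -
  have "x <#\<^bsub>sym_group d\<^esub> W \<in> lcosets\<^bsub>sym_group d\<^esub> W"
    using assms by (auto simp: LCOSETS_def)
  hence "\<exists>!j. j \<in> J \<inter> (x <#\<^bsub>sym_group d\<^esub> W)"
    using J by (auto simp: left_transversal_def)
  moreover have "j \<in> J \<inter> (x <#\<^bsub>sym_group d\<^esub> W) \<longleftrightarrow>
      j \<in> J \<and> inv\<^bsub>sym_group d\<^esub> j \<otimes>\<^bsub>sym_group d\<^esub> x \<in> W" for j
    using G.mem_l_coset_iff[OF W assms] transversal_carrier by blast
  ultimately show ?thesis by simp
qed

lemma transversal_action:
  assumes "\<zeta> \<in> carrier (sym_group d)" "i \<in> J"
  shows "transversal_action d W J \<zeta> i \<in> J"
    and "inv\<^bsub>sym_group d\<^esub> (transversal_action d W J \<zeta> i) \<otimes>\<^bsub>sym_group d\<^esub> \<zeta> \<otimes>\<^bsub>sym_group d\<^esub> i \<in> W"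
proof -
  have "\<exists>!j. j \<in> J \<and> inv\<^bsub>sym_group d\<^esub> j \<otimes>\<^bsub>sym_group d\<^esub> \<zeta> \<otimes>\<^bsub>sym_group d\<^esub> i \<in> W"
    using transversal_unique[of "\<zeta> \<otimes>\<^bsub>sym_group d\<^esub> i"] assms transversal_carrier
    by (simp add: G.m_assoc cong: conj_cong)
  from theI'[OF this] show "transversal_action d W J \<zeta> i \<in> J"
    and "inv\<^bsub>sym_group d\<^esub> (transversal_action d W J \<zeta> i) \<otimes>\<^bsub>sym_group d\<^esub> \<zeta> \<otimes>\<^bsub>sym_group d\<^esub> i \<in> W"
    by (simp_all add: transversal_action_def)
qed

lemma transversal_action_eqI:
  assumes "\<zeta> \<in> carrier (sym_group d)" "i \<in> J" "j \<in> J"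
    and "inv\<^bsub>sym_group d\<^esub> j \<otimes>\<^bsub>sym_group d\<^esub> \<zeta> \<otimes>\<^bsub>sym_group d\<^esub> i \<in> W"
  shows "transversal_action d W J \<zeta> i = j"
  using transversal_action[OF assms(1,2)] assms transversal_carrier
    transversal_unique[of "\<zeta> \<otimes>\<^bsub>sym_group d\<^esub> i"]
  by (auto simp: G.m_assoc)

lemma transversal_action_fixes_iff:
  assumes "\<zeta> \<in> carrier (sym_group d)" "i \<in> J"
  shows "transversal_action d W J \<zeta> i = i \<longleftrightarrow>
    inv\<^bsub>sym_group d\<^esub> i \<otimes>\<^bsub>sym_group d\<^esub> \<zeta> \<otimes>\<^bsub>sym_group d\<^esub> i \<in> W"
  using transversal_action_eqI[OF assms assms(2)] transversal_action(2)[OF assms] by auto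

text \<open>This identifies the stabilizer of one transversal element with a conjugate of
  \<open>W\<close>, by undoing the conjugation in
  \<open>transversal_action_fixes_iff\<close>.\<close>

lemma mem_conj_subgroup_iff:
  assumes "i \<in> J"
  shows "\<zeta> \<in> (i <#\<^bsub>sym_group d\<^esub> W) #>\<^bsub>sym_group d\<^esub> (inv\<^bsub>sym_group d\<^esub> i) \<longleftrightarrow>
    \<zeta> \<in> carrier (sym_group d) \<and> transversal_action d W J \<zeta> i = i"
proof
  have i: "i \<in> carrier (sym_group d)" using assms by (rule transversal_carrier)
  note W_carrier = subgroup.mem_carrier[OF W]
  {
    assume "\<zeta> \<in> (i <#\<^bsub>sym_group d\<^esub> W) #>\<^bsub>sym_group d\<^esub> (inv\<^bsub>sym_group d\<^esub> i)"
    then obtain w where w: "w \<in> W"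
      "\<zeta> = i \<otimes>\<^bsub>sym_group d\<^esub> w \<otimes>\<^bsub>sym_group d\<^esub> inv\<^bsub>sym_group d\<^esub> i"
      by (auto simp: r_coset_def l_coset_def)
    have "inv\<^bsub>sym_group d\<^esub> i \<otimes>\<^bsub>sym_group d\<^esub> \<zeta> \<otimes>\<^bsub>sym_group d\<^esub> i = w"
      using w i W_carrier by (simp add: G.m_assoc) (simp flip: G.m_assoc)
    with w i W_carrier assms
    show "\<zeta> \<in> carrier (sym_group d) \<and> transversal_action d W J \<zeta> i = i"
      by (simp add: transversal_action_fixes_iff)
  next
    assume *: "\<zeta> \<in> carrier (sym_group d) \<and> transversal_action d W J \<zeta> i = i"
    have "\<zeta> = i \<otimes>\<^bsub>sym_group d\<^esub>
        (inv\<^bsub>sym_group d\<^esub> i \<otimes>\<^bsub>sym_group d\<^esub> \<zeta> \<otimes>\<^bsub>sym_group d\<^esub> i) \<otimes>\<^bsub>sym_group d\<^esub>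
        inv\<^bsub>sym_group d\<^esub> i"
      using * i by (simp add: G.m_assoc) (simp flip: G.m_assoc)
    moreover have "inv\<^bsub>sym_group d\<^esub> i \<otimes>\<^bsub>sym_group d\<^esub> \<zeta> \<otimes>\<^bsub>sym_group d\<^esub> i \<in> W"
      using * assms by (simp flip: transversal_action_fixes_iff)
    ultimately show "\<zeta> \<in> (i <#\<^bsub>sym_group d\<^esub> W) #>\<^bsub>sym_group d\<^esub> (inv\<^bsub>sym_group d\<^esub> i)"
      unfolding r_coset_def l_coset_def by blast
  }
qed

text \<open>Sending \<open>j\<close> to its coset is a bijection onto the left cosets, and
  Lagrange's theorem counts these.\<close>

lemma card_transversal: "card J * card W = fact d"
proof -
  have "bij_betw (\<lambda>j. j <#\<^bsub>sym_group d\<^esub> W) J (lcosets\<^bsub>sym_group d\<^esub> W)"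
  proof (rule bij_betw_imageI)
    have self: "j \<in> j <#\<^bsub>sym_group d\<^esub> W" if "j \<in> J" for j
      using G.lcos_self[OF transversal_carrier[OF that] W] .
    have coset: "j <#\<^bsub>sym_group d\<^esub> W \<in> lcosets\<^bsub>sym_group d\<^esub> W" if "j \<in> J" for j
      using transversal_carrier[OF that] by (auto simp: LCOSETS_def)
    show "inj_on (\<lambda>j. j <#\<^bsub>sym_group d\<^esub> W) J"
      using J self coset unfolding left_transversal_def inj_on_def by (metis IntI)
    show "(\<lambda>j. j <#\<^bsub>sym_group d\<^esub> W) ` J = lcosets\<^bsub>sym_group d\<^esub> W"
    proof (intro equalityI subsetI)
      fix C assume C: "C \<in> lcosets\<^bsub>sym_group d\<^esub> W"
      then obtain j where j: "j \<in> J" "j \<in> C"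
        using J unfolding left_transversal_def by blast
      hence "C = j <#\<^bsub>sym_group d\<^esub> W"
        using G.lcos_disjoint[OF W C coset[OF j(1)]] self by blast
      thus "C \<in> (\<lambda>j. j <#\<^bsub>sym_group d\<^esub> W) ` J" using j by blast
    qed (use coset in auto)
  qed
  thus ?thesis
    using G.l_lagrange[OF finite_sym_group W] by (simp add: bij_betw_same_card order_sym_group)
qed

context
  fixes \<chi> :: "(nat \<Rightarrow> nat) \<Rightarrow> 'a::field_char_0"
  assumes \<chi>: "one_dim_character d W \<chi>"
begin

text \<open>If \<open>h\<close> moves \<open>x\<close> to \<open>y\<close> and \<open>g\<close>
  moves \<open>y\<close> to \<open>z\<close>, the element of \<open>W\<close> attached to the
  product splits at \<open>y\<close> into those attached to \<open>g\<close> and \<open>h\<close>.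
  Membership gives the action law, and \<open>\<chi>\<close> gives the cocycle law.\<close>

lemma monomial_action_transversal:
  "monomial_action (sym_group d) J (transversal_action d W J) (transversal_cocycle d W J \<chi>)"
proof unfold_locales
  show "finite J" by (rule finite_transversal)
next
  fix x assume x: "x \<in> J"
  have x_carrier: "x \<in> carrier (sym_group d)" using x by (rule transversal_carrier)
  have one_W: "inv\<^bsub>sym_group d\<^esub> x \<otimes>\<^bsub>sym_group d\<^esub> \<one>\<^bsub>sym_group d\<^esub> \<otimes>\<^bsub>sym_group d\<^esub> x = \<one>\<^bsub>sym_group d\<^esub>"
    using x_carrier by simp
  show one: "transversal_action d W J \<one>\<^bsub>sym_group d\<^esub> x = x"
    using x one_W subgroup.one_closed[OF W] by (simp add: transversal_action_fixes_iff)
  show "transversal_cocycle d W J \<chi> \<one>\<^bsub>sym_group d\<^esub> x = 1"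
    by (simp only: transversal_cocycle_def one one_W one_dim_character_one[OF \<chi> W])
next
  fix g h x assume g: "g \<in> carrier (sym_group d)" and h: "h \<in> carrier (sym_group d)" and x: "x \<in> J"
  define y where "y = transversal_action d W J h x"
  define z where "z = transversal_action d W J g y"
  note y = transversal_action[OF h x, folded y_def]
  note z = transversal_action[OF g y(1), folded z_def]
  note carrier = g h transversal_carrier[OF x] transversal_carrier[OF y(1)] transversal_carrier[OF z(1)]
  have cancel: "y \<otimes>\<^bsub>sym_group d\<^esub> (inv\<^bsub>sym_group d\<^esub> y \<otimes>\<^bsub>sym_group d\<^esub> w) = w"
    if "w \<in> carrier (sym_group d)" for w
    using that carrier by (simp flip: G.m_assoc)
  have eq: "inv\<^bsub>sym_group d\<^esub> z \<otimes>\<^bsub>sym_group d\<^esub> (g \<otimes>\<^bsub>sym_group d\<^esub> h) \<otimes>\<^bsub>sym_group d\<^esub> x =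
      (inv\<^bsub>sym_group d\<^esub> z \<otimes>\<^bsub>sym_group d\<^esub> g \<otimes>\<^bsub>sym_group d\<^esub> y) \<otimes>\<^bsub>sym_group d\<^esub>
      (inv\<^bsub>sym_group d\<^esub> y \<otimes>\<^bsub>sym_group d\<^esub> h \<otimes>\<^bsub>sym_group d\<^esub> x)"
    using carrier by (simp add: G.m_assoc cancel)
  have act: "transversal_action d W J (g \<otimes>\<^bsub>sym_group d\<^esub> h) x = z"
    using carrier x z(1) subgroup.m_closed[OF W z(2) y(2)]
    by (intro transversal_action_eqI) (simp_all add: eq)
  show "transversal_action d W J (g \<otimes>\<^bsub>sym_group d\<^esub> h) x =
      transversal_action d W J g (transversal_action d W J h x)"
    using act by (simp add: y_def z_def)
  show "transversal_cocycle d W J \<chi> (g \<otimes>\<^bsub>sym_group d\<^esub> h) x =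
      transversal_cocycle d W J \<chi> g (transversal_action d W J h x) * transversal_cocycle d W J \<chi> h x"
    unfolding transversal_cocycle_def act eq one_dim_character_mult[OF \<chi> z(2) y(2)]
    by (simp add: y_def z_def)
qed (rule transversal_action(1))

lemma induced_character_in_characters: "induced_character d W J \<chi> \<in> characters d"
  unfolding induced_character_def[abs_def]
  by (rule fixed_sum_in_characters[OF monomial_action_transversal])

text \<open>After exchanging the sums, each transversal element contributes a sum over a conjugate
  of \<open>W\<close>, equal to the sum over \<open>W\<close> itself. There are
  \<open>card J\<close> of them.\<close>

lemma gen_cyclic_index_eq_ch:
  "gen_cyclic_index d W \<chi> = ch d (induced_character d W J \<chi>)"
proof -
  let ?act = "transversal_action d W J" and ?b = "transversal_cocycle d W J \<chi>"
  let ?S = "\<Sum>w\<in>W. xconst (\<chi> w) * cycle_monomial d w"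
  \<comment> \<open>Conjugation by \<open>i\<close> maps \<open>W\<close> onto the stabilizer of
    \<open>i\<close>; it preserves cycle type, and the cocycle takes the value
    \<open>\<chi> w\<close> at the image of \<open>w\<close>.\<close>
  have conj: "(\<Sum>\<sigma>\<in>{\<sigma> \<in> carrier (sym_group d). ?act \<sigma> i = i}. xconst (?b \<sigma> i) * cycle_monomial d \<sigma>) = ?S"
    if i: "i \<in> J" for i
  proof -
    let ?c = "\<lambda>w. i \<otimes>\<^bsub>sym_group d\<^esub> w \<otimes>\<^bsub>sym_group d\<^esub> inv\<^bsub>sym_group d\<^esub> i"
    let ?c' = "\<lambda>\<sigma>. inv\<^bsub>sym_group d\<^esub> i \<otimes>\<^bsub>sym_group d\<^esub> \<sigma> \<otimes>\<^bsub>sym_group d\<^esub> i"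
    have i_carrier: "i \<in> carrier (sym_group d)" using i by (rule transversal_carrier)
    have cancel: "?c (?c' \<sigma>) = \<sigma>" "?c' (?c \<sigma>) = \<sigma>" if "\<sigma> \<in> carrier (sym_group d)" for \<sigma>
      using that i_carrier by (simp_all add: G.m_assoc) (simp_all flip: G.m_assoc)
    have W_carrier: "w \<in> carrier (sym_group d)" if "w \<in> W" for w
      using that by (rule subgroup.mem_carrier[OF W])
    show ?thesis
    proof (rule sum.reindex_bij_witness[where i = ?c and j = ?c'])
      fix \<sigma> assume \<sigma>: "\<sigma> \<in> {\<sigma> \<in> carrier (sym_group d). ?act \<sigma> i = i}"
      thus "?c (?c' \<sigma>) = \<sigma>" and "?c' \<sigma> \<in> W"
        using cancel(1) transversal_action_fixes_iff[OF _ i, of \<sigma>] by auto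
      have "cycle_monomial d \<sigma> = (cycle_monomial d (?c' \<sigma>) :: 'a xseries)"
        using \<sigma> cycle_monomial_conj[OF i_carrier, of "?c' \<sigma>"] cancel(1) i_carrier by simp
      thus "xconst (\<chi> (?c' \<sigma>)) * cycle_monomial d (?c' \<sigma>) = xconst (?b \<sigma> i) * cycle_monomial d \<sigma>"
        using \<sigma> by (simp add: transversal_cocycle_def)
    next
      fix w assume w: "w \<in> W"
      show "?c' (?c w) = w" using cancel w W_carrier by blast
      moreover have "?c w \<in> carrier (sym_group d)" using w W_carrier i_carrier by simp
      ultimately show "?c w \<in> {\<sigma> \<in> carrier (sym_group d). ?act \<sigma> i = i}"
        using w i by (simp add: transversal_action_fixes_iff)
    qed
  qed
  \<comment> \<open>Adding \<open>card J\<close> equal terms yields a natural multiple in the series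
    ring, which is rewritten as a constant to combine with the scalar in \<open>ch\<close>.\<close>
  have xconst_of_nat: "xconst (of_nat n) = (of_nat n :: 'a xseries)" for n
  proof (induction n)
    case (Suc n)
    have "xconst 1 = (1 :: 'a xseries)"
      by (rule xseries_eqI) (simp add: xcoeff_xconst one_xseries.rep_eq)
    with Suc show ?case by (simp add: xconst_add)
  qed simp
  have fixed_sum: "monomial_action.fixed_sum J ?act ?b \<sigma> = (\<Sum>i\<in>{i \<in> J. ?act \<sigma> i = i}. ?b \<sigma> i)" for \<sigma>
    by (rule monomial_action.fixed_sum_def[OF monomial_action_transversal])
  have "(\<Sum>\<sigma>\<in>carrier (sym_group d). xconst (induced_character d W J \<chi> \<sigma>) * cycle_monomial d \<sigma>) =
      (\<Sum>\<sigma>\<in>carrier (sym_group d). \<Sum>i\<in>{i \<in> J. ?act \<sigma> i = i}. xconst (?b \<sigma> i) * cycle_monomial d \<sigma>)"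
    by (simp add: induced_character_def fixed_sum xconst_sum sum_distrib_right)
  also have "\<dots> = (\<Sum>i\<in>J. \<Sum>\<sigma>\<in>{\<sigma> \<in> carrier (sym_group d). ?act \<sigma> i = i}.
      xconst (?b \<sigma> i) * cycle_monomial d \<sigma>)"
    using finite_sym_group finite_transversal by (rule sum.swap_restrict)
  also have "\<dots> = xconst (of_nat (card J)) * ?S"
    by (simp add: conj xconst_of_nat)
  finally have "ch d (induced_character d W J \<chi>) =
      xconst (1 / of_nat (fact d) * of_nat (card J)) * ?S"
    by (simp only: ch_def xconst_mult mult.assoc)
  also have "1 / of_nat (fact d) * of_nat (card J) = (1 / of_nat (card W) :: 'a)"
  proof -
    have "of_nat (card J) * of_nat (card W) = (of_nat (fact d) :: 'a)"
      using card_transversal by (simp flip: of_nat_mult)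
    moreover have "card W \<noteq> 0"
      using card_transversal by (metis fact_nonzero mult_0_right)
    ultimately show ?thesis by (simp add: field_simps)
  qed
  finally show ?thesis by (simp add: gen_cyclic_index_def)
qed

end

end

section \<open>The count of orbits with trivial stabilizer character\<close>

theorem theorem2p1p3:
  fixes d k :: nat
    and W :: "nat \<Rightarrow> (nat \<Rightarrow> nat) set"
    and I :: "nat \<Rightarrow> (nat \<Rightarrow> nat) set"
    and \<chi> :: "nat \<Rightarrow> (nat \<Rightarrow> nat) \<Rightarrow> 'a::{alg_closed_field, field_char_0}"
    and T :: "(nat \<Rightarrow> nat \<Rightarrow> nat) set"
  assumes "d \<ge> 1" and "k \<ge> 1"
    and "\<And>m. m \<in> {1..k} \<Longrightarrow> subgroup (W m) (sym_group d)"
    and "\<And>m. m \<in> {1..k} \<Longrightarrow> one_dim_character d (W m) (\<chi> m)"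
    and "\<And>m. m \<in> {1..k} \<Longrightarrow> left_transversal d (W m) (I m)"
    and "orbit_representatives d k W I T"
  shows "coeff_sum d (internal_prod_family d k (\<lambda>m. gen_cyclic_index d (W m) (\<chi> m))) =
         of_nat (card {\<omega> \<in> T. \<forall>\<zeta> \<in> conj_intersection d k W \<omega>. psi d k W I \<chi> \<omega> \<zeta> = 1})"
proof -
  let ?G = "sym_group d"
  let ?act = "\<lambda>m. transversal_action d (W m) (I m)"
  let ?b = "\<lambda>m. transversal_cocycle d (W m) (I m) (\<chi> m)"
  let ?u = "\<lambda>m. induced_character d (W m) (I m) (\<chi> m)"
  have mono: "monomial_action ?G (I m) (?act m) (?b m)" if "m \<in> {1..k}" for m
    using that assms(3-5) by (intro monomial_action_transversal)
  have act_eq: "tuple_action d j W I = (\<lambda>g \<omega>. \<lambda>m\<in>{1..j}. ?act m g (\<omega> m))" for j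
    by (simp add: fun_eq_iff tuple_action_def)
  have beta_eq: "beta d j W I \<chi> = (\<lambda>\<omega> \<zeta>. \<Prod>m = 1..j. ?b m \<zeta> (\<omega> m))" for j
    by (simp add: fun_eq_iff beta_def transversal_cocycle_def)
  let ?beta = "\<lambda>j \<zeta> \<omega>. beta d j W I \<chi> \<omega> \<zeta>"
  \<comment> \<open>All lengths \<open>j\<close> up to \<open>k\<close> are treated, because the
    partial products in the fold have to be characters too.\<close>
  have mono_tuples: "monomial_action ?G (tuples j I) (tuple_action d j W I) (?beta j)"
    and prod_eq: "(\<lambda>\<sigma>. \<Prod>m = 1..j. ?u m \<sigma>) = (\<lambda>\<sigma>. if \<sigma> \<in> carrier ?G then
      monomial_action.fixed_sum (tuples j I) (tuple_action d j W I) (?beta j) \<sigma> else 0)"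
    if j: "j \<in> {1..k}" for j
  proof -
    have mono_j: "monomial_action ?G (I m) (?act m) (?b m)" if "m \<in> {1..j}" for m
      using that j by (intro mono) auto
    show "monomial_action ?G (tuples j I) (tuple_action d j W I) (?beta j)"
      unfolding act_eq beta_eq tuples_def
      using mono_j by (intro monomial_action_PiE sym_group_is_group) auto
    have "(\<Prod>m = 1..j. ?u m \<sigma>) =
        monomial_action.fixed_sum (tuples j I) (tuple_action d j W I) (?beta j) \<sigma>"
      if "\<sigma> \<in> carrier ?G" for \<sigma>
      unfolding act_eq beta_eq tuples_def
      using that fixed_sum_PiE[where X = I and act = ?act and b = ?b and g = \<sigma>,
          OF sym_group_is_group finite_atLeastAtMost mono_j]
      by (simp only: induced_character_def if_True)
    moreover have "(\<Prod>m = 1..j. ?u m \<sigma>) = 0" if "\<sigma> \<notin> carrier ?G" for \<sigma>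
      using j that by (simp add: induced_character_def)
    ultimately show "(\<lambda>\<sigma>. \<Prod>m = 1..j. ?u m \<sigma>) = (\<lambda>\<sigma>. if \<sigma> \<in> carrier ?G then
      monomial_action.fixed_sum (tuples j I) (tuple_action d j W I) (?beta j) \<sigma> else 0)"
      by auto
  qed
  have k: "k \<in> {1..k}" using assms(2) by simp
  interpret M: monomial_action ?G "tuples k I" "tuple_action d k W I" "?beta k"
    using k by (rule mono_tuples)

  have T: "T \<subseteq> tuples k I"
    "\<And>C. C \<in> orbits ?G (tuples k I) (tuple_action d k W I) \<Longrightarrow> \<exists>!\<omega>. \<omega> \<in> T \<inter> C"
    using assms(6) by (auto simp: orbit_representatives_def)
  \<comment> \<open>Since \<open>k\<close> is positive, the intersection has at least one factor,
    and membership in it includes membership in the group.\<close>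
  have stab: "M.stab \<omega> = conj_intersection d k W \<omega>" if "\<omega> \<in> tuples k I" for \<omega>
  proof -
    have I: "\<omega> m \<in> I m" if "m \<in> {1..k}" for m
      using \<open>\<omega> \<in> tuples k I\<close> that by (auto simp: tuples_def)
    have "tuple_action d k W I \<zeta> \<omega> = \<omega> \<longleftrightarrow> (\<forall>m\<in>{1..k}. ?act m \<zeta> (\<omega> m) = \<omega> m)" for \<zeta>
      using that by (auto simp: tuple_action_def tuples_def fun_eq_iff PiE_iff extensional_def restrict_def)
    moreover have "\<zeta> \<in> conj_intersection d k W \<omega> \<longleftrightarrow>
        (\<forall>m\<in>{1..k}. \<zeta> \<in> carrier ?G \<and> ?act m \<zeta> (\<omega> m) = \<omega> m)" for \<zeta>
      using mem_conj_subgroup_iff[OF assms(3) assms(5) I] by (simp add: conj_intersection_def)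
    ultimately show ?thesis unfolding M.stab_def using k by blast
  qed

  have "internal_prod_family d k (\<lambda>m. gen_cyclic_index d (W m) (\<chi> m)) =
      ch d (\<lambda>\<sigma>. \<Prod>m = 1..k. ?u m \<sigma>)"
  proof (rule internal_prod_family_ch)
    show "gen_cyclic_index d (W m) (\<chi> m) = ch d (?u m)" if "m \<in> {1..k}" for m
      using that assms(3-5) by (intro gen_cyclic_index_eq_ch)
    show "?u m \<in> virtual_characters d" if "m \<in> {1..k}" for m
      using that assms(3-5) induced_character_in_characters characters_subset_virtual_characters
      by blast
    show "(\<lambda>\<sigma>. \<Prod>m = 1..j. ?u m \<sigma>) \<in> virtual_characters d" if "j \<in> {1..k}" for j
      unfolding prod_eq[OF that]
      using fixed_sum_in_characters[OF mono_tuples[OF that]] characters_subset_virtual_characters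
      by blast
  qed (rule assms(2))
  hence "coeff_sum d (internal_prod_family d k (\<lambda>m. gen_cyclic_index d (W m) (\<chi> m))) =
      (\<Sum>\<sigma>\<in>carrier ?G. if \<sigma> \<in> carrier ?G then M.fixed_sum \<sigma> else 0) / of_nat (fact d)"
    by (simp only: coeff_sum_ch prod_eq[OF k])
  also have "\<dots> = (\<Sum>\<sigma>\<in>carrier ?G. M.fixed_sum \<sigma>) / of_nat (fact d)"
    by simp
  \<comment> \<open>The group order in the weighted orbit count cancels against the
    \<open>fact d\<close> of the average.\<close>
  also have "\<dots> = of_nat (card {\<omega> \<in> T. \<forall>\<zeta>\<in>M.stab \<omega>. beta d k W I \<chi> \<omega> \<zeta> = 1})"
    using M.sum_fixed_sum[OF finite_sym_group T] by (simp add: order_sym_group)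
  \<comment> \<open>On the stabilizer the restriction \<open>psi\<close> agrees with
    \<open>beta\<close>; its default value elsewhere is never tested.\<close>
  also have "{\<omega> \<in> T. \<forall>\<zeta>\<in>M.stab \<omega>. beta d k W I \<chi> \<omega> \<zeta> = 1} =
      {\<omega> \<in> T. \<forall>\<zeta> \<in> conj_intersection d k W \<omega>. psi d k W I \<chi> \<omega> \<zeta> = 1}"
    using T(1) stab by (auto simp: psi_def)
  finally show ?thesis .
qed

end
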